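(* There is an absolute constant $C$ such that, for every integer $N\ge0$, every collection $\mathcal{A}\subset\mathcal{D}_N$, every $n\ge1$, and all $x_1,\dots,x_n\in L_1^N$, $$\biggl(\sum_{j=1}^n\|x_j+Y\|_{L_1/Y}^2\biggr)^{1/2}\le C\,\mathbb{E}_\varepsilon\biggl\|\sum_{j=1}^n\varepsilon_jx_j+Y\biggr\|_{L_1/Y},$$ where $Y=\operatorname{span}\{h_I:I\in\mathcal{A}\}$ and $\mathbb{E}_\varepsilon$ is the average over all sign vectors $\varepsilon\in\{-1,1\}^n$.
   Context: $L_1=L_1([0,1])$ is the space of (classes of) real-valued Lebesgue integrable functions with norm $\|f\|_{L_1}=\int_0^1|f|\,dt$. The collection of dyadic intervals is $\mathcal{D}=\{[\frac{i-1}{2^n},\frac{i}{2^n}):1\le i\le 2^n,\ n\in\mathbb{N}_0\}$, where $\mathbb{N}_0=\mathbb{N}\cup\{0\}$, and for $N\in\mathbb{N}_0$, $\mathcal{D}_N=\{I\in\mathcal{D}:|I|\ge2^{-N}\}$. For $I\in\mathcal{D}$, $I^+$ denotes the left half of $I$ and $I^-$ its right half, and the Haar function is $h_I=\mathbf{1}_{I^+}-\mathbf{1}_{I^-}$. The space $L_1^N$ is $\operatorname{span}(\{\mathbf{1}_{[0,1)}\}\cup\{h_I:I\in\mathcal{D}_N\})$. The quotient norm is $\|x+Y\|_{L_1/Y}=\inf_{y\in Y}\|x+y\|_{L_1}$. *)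

theory Defs
  imports "HOL-Analysis.Analysis" "HOL-Library.Function_Algebras"
begin

text \<open>Pointwise scalar multiplication, so that \<open>span\<close> is available for functions.\<close>

instantiation "fun" :: (type, real_vector) real_vector
begin

definition scaleR_fun :: "real \<Rightarrow> ('a \<Rightarrow> 'b) \<Rightarrow> 'a \<Rightarrow> 'b" where
  "scaleR_fun c f = (\<lambda>t. c *\<^sub>R f t)"

instance
  by standard (simp_all add: scaleR_fun_def fun_eq_iff algebra_simps)

end

text \<open>
  Elements of \<open>L\<^sub>1([0,1])\<close> are represented by functions on the real line. This is harmless: all
  functions below are step functions, and \<open>L1_norm\<close> depends only on the values almost everywhere
  on \<open>[0,1]\<close>. For a non-integrable \<open>f\<close> the value of \<open>L1_norm f\<close> is meaningless.
\<close>

definition L1_norm :: "(real \<Rightarrow> real) \<Rightarrow> real" where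
  "L1_norm f = (LINT t:{0..1}|lborel. \<bar>f t\<bar>)"

definition quotient_norm :: "(real \<Rightarrow> real) set \<Rightarrow> (real \<Rightarrow> real) \<Rightarrow> real" where
  "quotient_norm Y x = (INF y\<in>Y. L1_norm (x + y))"

definition dyadic :: "real set set" where
  "dyadic = {{(real i - 1) / 2 ^ n ..< real i / 2 ^ n} | i n. 1 \<le> i \<and> i \<le> 2 ^ n}"

definition dyadic_upto :: "nat \<Rightarrow> real set set" where
  "dyadic_upto N = {I \<in> dyadic. measure lborel I \<ge> 1 / 2 ^ N}"

text \<open>
  The midpoint of \<open>I = {a..<b}\<close> is \<open>(Inf I + Sup I) / 2\<close>, so the two halves are
  \<open>{a..<(a + b) / 2}\<close> and \<open>{(a + b) / 2..<b}\<close>.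
\<close>

definition left_half :: "real set \<Rightarrow> real set" where
  "left_half I = {t \<in> I. t < (Inf I + Sup I) / 2}"

definition right_half :: "real set \<Rightarrow> real set" where
  "right_half I = {t \<in> I. t \<ge> (Inf I + Sup I) / 2}"

definition haar :: "real set \<Rightarrow> real \<Rightarrow> real" where
  "haar I = indicator (left_half I) - indicator (right_half I)"

definition L1_level :: "nat \<Rightarrow> (real \<Rightarrow> real) set" where
  "L1_level N = span ({indicator {0..<1}} \<union> haar ` dyadic_upto N)"

definition sign_vectors :: "nat \<Rightarrow> (nat \<Rightarrow> real) set" where
  "sign_vectors n = {1..n} \<rightarrow>\<^sub>E {-1, 1}"

definition sign_average :: "nat \<Rightarrow> ((nat \<Rightarrow> real) \<Rightarrow> real) \<Rightarrow> real" where
  "sign_average n F = (\<Sum>\<epsilon>\<in>sign_vectors n. F \<epsilon>) / real (card (sign_vectors n))"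

end

theory Submission
  imports Defs
begin

text \<open>
  By duality it suffices to lift: if \<open>\<Phi>\<^sub>1, \<dots>, \<Phi>\<^sub>n\<close> annihilate \<open>Y\<close> and \<open>\<Sum> \<Phi>\<^sub>j\<^sup>2 \<le> 1\<close> pointwise, we
  want \<open>\<Psi>(\<epsilon>)\<close> annihilating \<open>Y\<close>, bounded by an absolute constant, such that the Rademacher coefficients of
  \<open>\<Psi>\<close> are pointwise within \<open>1/2\<close> of \<open>\<Phi>\<close> in \<open>\<ell>\<^sub>2\<close>. Pairing with \<open>\<Sum> \<epsilon>\<^sub>j x\<^sub>j\<close>, the supremum \<open>K\<close> of
  \<open>\<Sum> \<langle>\<Phi>\<^sub>j, x\<^sub>j\<rangle>\<close> over all such \<open>\<Phi>\<close> satisfies \<open>K \<le> C E + K / 2\<close> with \<open>E\<close> the average on the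
  right-hand side, and norming functionals for the \<open>x\<^sub>j\<close> turn the bound on \<open>K\<close> into the theorem.

  Annihilating \<open>Y\<close> means that a dyadic martingale does not move at the nodes in \<open>\<A>\<close>, so \<open>\<Psi>\<close> can be
  built from the root downwards as the response in a game: when \<open>\<Phi>\<close> moves by \<open>\<plusminus> b\<close>, the player moves
  \<open>\<Psi>\<close> by \<open>\<plusminus> \<eta>\<close>. The player keeps the mean square (over \<open>\<epsilon>\<close>) of the discrepancy between \<open>\<Psi>\<close> and
  \<open>\<Sum> \<epsilon>\<^sub>j \<Phi>\<^sub>j\<close> below \<open>u + p \<bar>\<Phi>\<bar>\<^sup>2\<close> for suitable small constants \<open>p < u\<close>: the discrepancy forced by the bound
  on \<open>\<Psi>\<close> is of second order in \<open>b\<close> and is absorbed by the growth \<open>p \<bar>b\<bar>\<^sup>2\<close>, while the first-order terms are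
  matched by stretching or shrinking the present discrepancy.
\<close>

section \<open>The saturating coordinate\<close>

text \<open>
  The inverse of a smooth saturation map onto \<open>(-1, 1)\<close>. A symmetric move \<open>s \<plusminus> \<eta>\<close> of the bounded
  coordinate moves \<open>saturate_inv s\<close> symmetrically up to a second-order error that becomes relatively
  smaller near the boundary, so no coordinate ever gets stuck there.
\<close>

definition saturate_inv :: "real \<Rightarrow> real" where
  "saturate_inv s = s / (1 - s\<^sup>2)"

lemma saturate_inv_surj:
  obtains s where "\<bar>s\<bar> < 1" "saturate_inv s = v"
proof -
  define r where "r = sqrt (1 + 4 * v\<^sup>2)"
  have r: "r \<ge> 1" "r\<^sup>2 = 1 + 4 * v\<^sup>2"
    by (auto simp: r_def)
  \<comment> \<open>The root in \<open>(-1, 1)\<close> of \<open>v * s\<^sup>2 + s - v = 0\<close>,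
    rationalized so that \<open>v = 0\<close> needs no separate treatment.\<close>
  define s where "s = 2 * v / (1 + r)"
  have rv: "2 * \<bar>v\<bar> \<le> r"
    unfolding r_def by (rule real_le_rsqrt) (auto simp: power_mult_distrib)
  have s1: "\<bar>s\<bar> < 1"
    using r rv by (simp add: s_def abs_mult abs_divide)
  have "1 - s\<^sup>2 = ((1 + r)\<^sup>2 - 4 * v\<^sup>2) / (1 + r)\<^sup>2"
    using r by (simp add: s_def power_divide power_mult_distrib field_simps)
  also have "(1 + r)\<^sup>2 - 4 * v\<^sup>2 = 2 * (1 + r)"
    using r by (simp add: power2_sum)
  also have "2 * (1 + r) / (1 + r)\<^sup>2 = 2 / (1 + r)"
    using r by (simp add: power2_eq_square divide_simps)
  finally have "saturate_inv s = v"
    using r by (simp add: saturate_inv_def s_def)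
  with s1 show ?thesis by (rule that)
qed

text \<open>Separates the poles at 1 and -1, so that a shift of \<open>s\<close> can be expanded at
  each pole by itself.\<close>

lemma saturate_inv_partial_fractions:
  assumes "\<bar>s\<bar> < 1"
  shows "saturate_inv s = (1 / (1 - s) - 1 / (1 + s)) / 2"
proof -
  have eq: "1 - s\<^sup>2 = (1 - s) * (1 + s)"
    by (simp add: power2_eq_square algebra_simps)
  have "1 / (1 - s) - 1 / (1 + s) = 2 * s / ((1 - s) * (1 + s))"
    using assms by (simp add: diff_frac_eq)
  then show ?thesis
    by (simp add: saturate_inv_def eq)
qed

text \<open>The first-order remainder is exactly \<open>t\<^sup>2 / (y\<^sup>2 * (y - t))\<close>,
  and \<open>y - t\<close> stays above \<open>y / 2\<close>. Its sign is recorded because in a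
  difference of two such remainders only the larger one counts.\<close>

lemma inverse_shift_expansion:
  fixes y t :: real
  assumes "y > 0" "2 * \<bar>t\<bar> \<le> y"
  shows "0 \<le> 1 / (y - t) - 1 / y - t / y\<^sup>2" "1 / (y - t) - 1 / y - t / y\<^sup>2 \<le> 2 * t\<^sup>2 / y ^ 3"
proof -
  have y: "y - t > 0" "y \<le> 2 * (y - t)"
    using assms by auto
  have eq: "1 / (y - t) - 1 / y - t / y\<^sup>2 = t\<^sup>2 / (y\<^sup>2 * (y - t))"
    using y assms(1) by (simp add: field_simps power2_eq_square)
  show "0 \<le> 1 / (y - t) - 1 / y - t / y\<^sup>2"
    unfolding eq using y by simp
  have "t\<^sup>2 / (y\<^sup>2 * (y - t)) \<le> t\<^sup>2 / (y\<^sup>2 * (y / 2))"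
    using y assms(1) by (intro divide_left_mono mult_left_mono) auto
  then show "1 / (y - t) - 1 / y - t / y\<^sup>2 \<le> 2 * t\<^sup>2 / y ^ 3"
    unfolding eq by (simp add: power2_eq_square power3_eq_cube mult_ac)
qed

text \<open>One \<open>\<eta>\<close> has to serve both signs. The derivative of
  \<open>saturate_inv\<close> at \<open>s\<close> is \<open>(a\<^sup>2 + b\<^sup>2) / 2\<close>,
  with \<open>a\<close> and \<open>b\<close> the reciprocal distances to the poles; dividing
  \<open>h\<close> by it matches the first order and leaves an error of order
  \<open>h\<^sup>2 / m\<close>, \<open>m = max a b\<close>. Since
  \<open>m \<ge> 2 * \<bar>saturate_inv s\<bar>\<close>, moves far out are relatively more accurate;
  the bounds on \<open>k\<close> record this.\<close>

lemma saturate_inv_shift: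
  assumes s: "\<bar>s\<bar> < 1" and h: "\<bar>h\<bar> \<le> 1 / 8 + \<bar>saturate_inv s\<bar> / 4"
  obtains \<eta> k where "0 \<le> k" "k \<le> 4" "\<bar>saturate_inv s\<bar> * k \<le> 2" "k * \<bar>h\<bar> \<le> 1"
    "\<And>\<sigma>. \<sigma> \<in> {1, -1} \<Longrightarrow> \<bar>s + \<sigma> * \<eta>\<bar> < 1"
    "\<And>\<sigma>. \<sigma> \<in> {1, -1} \<Longrightarrow> \<bar>saturate_inv (s + \<sigma> * \<eta>) - saturate_inv s - \<sigma> * h\<bar> \<le> k * h\<^sup>2"
proof -
  define a where "a = 1 / (1 - s)"
  define b where "b = 1 / (1 + s)"
  define m where "m = max a b"
  have pos: "a > 0" "b > 0" "1 - s > 0" "1 + s > 0"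
    using s by (auto simp: a_def b_def)
  have m1: "m \<ge> 1"
  proof (cases "s \<ge> 0")
    case True
    then have "a \<ge> 1" using s by (simp add: a_def)
    then show ?thesis by (simp add: m_def)
  next
    case False
    then have "b \<ge> 1" using s by (simp add: b_def)
    then show ?thesis by (simp add: m_def)
  qed
  have g: "saturate_inv s = (a - b) / 2"
    using saturate_inv_partial_fractions[OF s] by (simp add: a_def b_def)
  have gm: "2 * \<bar>saturate_inv s\<bar> \<le> m"
    unfolding g using pos by (simp add: m_def max_def abs_le_iff)
  have hm: "\<bar>h\<bar> \<le> m / 4"
    using h gm m1 by linarith
  define \<eta> where "\<eta> = 2 * h / (a\<^sup>2 + b\<^sup>2)"
  have ab: "a\<^sup>2 + b\<^sup>2 \<ge> m\<^sup>2" "a\<^sup>2 + b\<^sup>2 > 0"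
    using pos by (auto simp: m_def max_def add_pos_pos)
  have \<eta>: "\<bar>\<eta>\<bar> \<le> 2 * \<bar>h\<bar> / m\<^sup>2"
    unfolding \<eta>_def abs_divide using ab m1
    by (simp add: abs_mult frac_le)
  also have "\<dots> \<le> 2 * (m / 4) / m\<^sup>2"
    using hm m1 by (intro divide_right_mono mult_left_mono) auto
  also have "\<dots> = 1 / (2 * m)"
    using m1 by (simp add: power2_eq_square)
  finally have \<eta>m: "2 * \<bar>\<eta>\<bar> \<le> 1 / m"
    by simp
  have ma: "1 / m \<le> 1 - s" "1 / m \<le> 1 + s"
  proof -
    have "1 / m \<le> 1 / a" "1 / m \<le> 1 / b"
      using pos m1 by (auto simp: m_def intro!: divide_left_mono mult_pos_pos)
    then show "1 / m \<le> 1 - s" "1 / m \<le> 1 + s" by (auto simp: a_def b_def)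
  qed
  \<comment> \<open>\<open>k = 4 / m\<close> arises because the error is at most
    \<open>t\<^sup>2 * m ^ 3\<close> with
    \<open>\<bar>t\<bar> \<le> 2 * \<bar>h\<bar> / m\<^sup>2\<close>.\<close>
  show ?thesis
  proof (rule that[of "4 / m" \<eta>])
    show "0 \<le> 4 / m" "4 / m \<le> 4" using m1 by (auto simp: field_simps)
    show "\<bar>saturate_inv s\<bar> * (4 / m) \<le> 2" using gm m1 by (simp add: field_simps)
    show "4 / m * \<bar>h\<bar> \<le> 1" using hm m1 by (simp add: field_simps)
    fix \<sigma> :: real assume \<sigma>: "\<sigma> \<in> {1, -1}"
    define t where "t = \<sigma> * \<eta>"
    have t: "\<bar>t\<bar> = \<bar>\<eta>\<bar>" "t\<^sup>2 = \<eta>\<^sup>2" using \<sigma> by (auto simp: t_def)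
    have "\<bar>t\<bar> < 1 / m" using \<eta>m m1 t by (smt (verit) divide_pos_pos)
    then show s': "\<bar>s + \<sigma> * \<eta>\<bar> < 1"
      using ma unfolding t_def[symmetric] by linarith
    have A: "0 \<le> 1 / (1 - s - t) - a - t * a\<^sup>2" "1 / (1 - s - t) - a - t * a\<^sup>2 \<le> 2 * (t\<^sup>2 * a ^ 3)"
      using inverse_shift_expansion[of "1 - s" t] pos \<eta>m ma t by (auto simp: a_def power_divide)
    have B: "0 \<le> 1 / (1 + s + t) - b + t * b\<^sup>2" "1 / (1 + s + t) - b + t * b\<^sup>2 \<le> 2 * (t\<^sup>2 * b ^ 3)"
      using inverse_shift_expansion[of "1 + s" "- t"] pos \<eta>m ma t by (auto simp: b_def power_divide)
    have am: "2 * (t\<^sup>2 * a ^ 3) \<le> 2 * (t\<^sup>2 * m ^ 3)" "2 * (t\<^sup>2 * b ^ 3) \<le> 2 * (t\<^sup>2 * m ^ 3)"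
      using pos by (auto simp: m_def intro!: mult_left_mono power_mono)
    have "\<sigma> * h = t * (a\<^sup>2 + b\<^sup>2) / 2"
      using pos by (simp add: t_def \<eta>_def)
    moreover have "saturate_inv (s + t) = (1 / (1 - s - t) - 1 / (1 + s + t)) / 2"
      using saturate_inv_partial_fractions[of "s + t"] s' by (simp add: t_def algebra_simps)
    ultimately have eq: "saturate_inv (s + t) - saturate_inv s - \<sigma> * h =
      ((1 / (1 - s - t) - a - t * a\<^sup>2) - (1 / (1 + s + t) - b + t * b\<^sup>2)) / 2"
      by (simp add: g field_simps)
    have half_diff: "\<bar>(x - y) / 2\<bar> \<le> w" if "0 \<le> x" "x \<le> 2 * w" "0 \<le> y" "y \<le> 2 * w" for x y w :: real
      using that unfolding abs_le_iff by (simp add: field_simps)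
    have "\<bar>saturate_inv (s + t) - saturate_inv s - \<sigma> * h\<bar> \<le> t\<^sup>2 * m ^ 3"
      unfolding eq
      by (rule half_diff[OF A(1) order_trans[OF A(2) am(1)] B(1) order_trans[OF B(2) am(2)]])
    also have "t\<^sup>2 * m ^ 3 \<le> (2 * \<bar>h\<bar> / m\<^sup>2)\<^sup>2 * m ^ 3"
    proof (rule mult_right_mono)
      have "\<bar>\<eta>\<bar>\<^sup>2 \<le> (2 * \<bar>h\<bar> / m\<^sup>2)\<^sup>2" using \<eta> by (intro power_mono) auto
      then show "t\<^sup>2 \<le> (2 * \<bar>h\<bar> / m\<^sup>2)\<^sup>2" by (simp add: t)
    qed (use m1 in simp)
    also have "\<dots> = 4 / m * h\<^sup>2"
      using m1 by (simp add: power_divide power_mult_distrib field_simps eval_nat_numeral)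
    finally show "\<bar>saturate_inv (s + \<sigma> * \<eta>) - saturate_inv s - \<sigma> * h\<bar> \<le> 4 / m * h\<^sup>2"
      by (simp add: t_def)
  qed
qed

text \<open>Here \<open>z\<close> is the old discrepancy, \<open>c * z + b\<close> the intended
  move, \<open>d\<close> the part of the increment not followed and \<open>r\<close> the saturation
  error. The terms odd in \<open>\<sigma>\<close> that do not involve \<open>r\<close> are kept
  exactly, up to the product with \<open>c * d\<close>, since they must later be balanced for both
  signs; everything else is estimated to second order.\<close>

lemma compensated_move_square:
  fixes z c d h b r k v :: real
  assumes k: "0 \<le> k" "k \<le> 4" "\<bar>v\<bar> * k \<le> 2" "k * \<bar>h\<bar> \<le> 1"
    and r: "\<bar>r\<bar> \<le> k * h\<^sup>2" and z: "\<bar>z\<bar> \<le> 2 * \<bar>v\<bar> + 1 / 16" and c: "\<bar>c\<bar> \<le> 1 / 8"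
    and h: "h = c * z + b" and \<sigma>: "\<sigma> \<in> {1, -1::real}" 
  shows "(z + \<sigma> * c * z - \<sigma> * d + r)\<^sup>2 \<le> z\<^sup>2 + 2 * \<sigma> * (c * z\<^sup>2 - z * d) + 33 * (c\<^sup>2 * z\<^sup>2) + 3 * d\<^sup>2
    + 18 * (\<bar>z\<bar> * b\<^sup>2) + 512 * b ^ 4"
proof -
  have h2: "h\<^sup>2 \<le> 2 * (c\<^sup>2 * z\<^sup>2) + 2 * b\<^sup>2"
    unfolding h using sum_squares_bound[of "c * z" b] by (simp add: power2_sum power_mult_distrib)
  \<comment> \<open>Although \<open>z\<close> is unbounded, \<open>k\<close> decays like
    \<open>1 / \<bar>v\<bar>\<close>; hence \<open>z * r\<close> is still of second order.\<close>
  have zk: "\<bar>z\<bar> * k \<le> 5"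
  proof -
    have "\<bar>z\<bar> * k \<le> (2 * \<bar>v\<bar> + 1 / 16) * k" using z k by (intro mult_right_mono)
    also have "\<dots> = 2 * (\<bar>v\<bar> * k) + k / 16" by (simp add: algebra_simps)
    finally show ?thesis using k by linarith
  qed
  have zr: "\<bar>z\<bar> * \<bar>r\<bar> \<le> 10 * (c\<^sup>2 * z\<^sup>2) + 8 * (\<bar>z\<bar> * b\<^sup>2)"
  proof -
    have "\<bar>z\<bar> * \<bar>r\<bar> \<le> \<bar>z\<bar> * (k * h\<^sup>2)" using r by (intro mult_left_mono) auto
    also have "\<dots> \<le> \<bar>z\<bar> * (k * (2 * (c\<^sup>2 * z\<^sup>2) + 2 * b\<^sup>2))"
      using h2 k by (intro mult_left_mono) auto
    also have "\<dots> = (\<bar>z\<bar> * k) * (2 * (c\<^sup>2 * z\<^sup>2)) + k * (2 * (\<bar>z\<bar> * b\<^sup>2))"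
      by (simp add: algebra_simps)
    also have "\<dots> \<le> 5 * (2 * (c\<^sup>2 * z\<^sup>2)) + 4 * (2 * (\<bar>z\<bar> * b\<^sup>2))"
      using zk k by (intro add_mono mult_right_mono) auto
    finally show ?thesis by simp
  qed
  have r2: "r\<^sup>2 \<le> 256 * b ^ 4 + 4 * (c\<^sup>2 * z\<^sup>2)"
  proof -
    have r2: "r\<^sup>2 \<le> (k * h\<^sup>2)\<^sup>2"
      using r k by (intro abs_le_square_iff[THEN iffD1]) auto
    show ?thesis
    \<comment> \<open>If \<open>b\<close> dominates, a fourth power of \<open>b\<close> is
      affordable. If \<open>c * z\<close> dominates, a fourth power is not, as \<open>z\<close> is
      unbounded; there \<open>k * \<bar>h\<bar> \<le> 1\<close> removes two of the four factors
      \<open>h\<close>.\<close>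
    proof (cases "\<bar>c * z\<bar> \<le> \<bar>b\<bar>")
      case True
      then have "\<bar>h\<bar> \<le> 2 * \<bar>b\<bar>" unfolding h by linarith
      then have "h\<^sup>2 \<le> (2 * \<bar>b\<bar>)\<^sup>2" by (intro abs_le_square_iff[THEN iffD1]) auto
      then have "k * h\<^sup>2 \<le> 4 * (2 * \<bar>b\<bar>)\<^sup>2" using k by (intro mult_mono) auto
      then have "(k * h\<^sup>2)\<^sup>2 \<le> (4 * (2 * \<bar>b\<bar>)\<^sup>2)\<^sup>2" using k by (intro power_mono) auto
      also have "\<dots> = 256 * b ^ 4" by (simp add: power_mult_distrib flip: power_mult)
      finally have "r\<^sup>2 \<le> 256 * b ^ 4" using r2 by linarith
      moreover have "0 \<le> c\<^sup>2 * z\<^sup>2" by simp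
      ultimately show ?thesis by linarith
    next
      case False
      then have "\<bar>h\<bar> \<le> 2 * \<bar>c * z\<bar>" unfolding h by linarith
      then have "h\<^sup>2 \<le> (2 * \<bar>c * z\<bar>)\<^sup>2" by (intro abs_le_square_iff[THEN iffD1]) auto
      then have h2': "h\<^sup>2 \<le> 4 * (c\<^sup>2 * z\<^sup>2)" by (simp add: power_mult_distrib)
      have "(k * h\<^sup>2)\<^sup>2 = (k * \<bar>h\<bar>)\<^sup>2 * h\<^sup>2" by (simp add: power2_eq_square algebra_simps)
      also have "\<dots> \<le> 1\<^sup>2 * h\<^sup>2" using k by (intro mult_right_mono power_mono) auto
      finally have "r\<^sup>2 \<le> 4 * (c\<^sup>2 * z\<^sup>2)" using r2 h2' by simp
      moreover have "0 \<le> b ^ 4" by simp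
      ultimately show ?thesis by linarith
    qed
  qed
  have cz: "2 * \<bar>c * z * d\<bar> \<le> c\<^sup>2 * z\<^sup>2 + d\<^sup>2"
    using sum_squares_bound[of "\<bar>c * z\<bar>" "\<bar>d\<bar>"] by (simp add: power_mult_distrib abs_mult)
  have dr: "2 * \<bar>d * r\<bar> \<le> d\<^sup>2 + r\<^sup>2"
    using sum_squares_bound[of "\<bar>d\<bar>" "\<bar>r\<bar>"] by (simp add: abs_mult)
  have crz: "\<bar>c * (z * r)\<bar> \<le> (1 / 8) * (\<bar>z\<bar> * \<bar>r\<bar>)"
    unfolding abs_mult using c by (intro mult_right_mono) auto
  have "(z + \<sigma> * c * z - \<sigma> * d + r)\<^sup>2 = z\<^sup>2 + 2 * \<sigma> * (c * z\<^sup>2 - z * d) + (\<sigma> * \<sigma>) * (c\<^sup>2 * z\<^sup>2 - 2 * (c * z * d) + d\<^sup>2)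
    + 2 * (z * r) + 2 * \<sigma> * (c * (z * r)) - 2 * \<sigma> * (d * r) + r\<^sup>2"
    by (simp add: power2_eq_square algebra_simps)
  also have "\<dots> \<le> z\<^sup>2 + 2 * \<sigma> * (c * z\<^sup>2 - z * d) + (c\<^sup>2 * z\<^sup>2 + 2 * \<bar>c * z * d\<bar> + d\<^sup>2)
    + 2 * (\<bar>z\<bar> * \<bar>r\<bar>) + 2 * \<bar>c * (z * r)\<bar> + 2 * \<bar>d * r\<bar> + r\<^sup>2"
    using \<sigma> by (auto simp: abs_mult[symmetric])
  also have "\<dots> \<le> z\<^sup>2 + 2 * \<sigma> * (c * z\<^sup>2 - z * d) + (65 / 2) * (c\<^sup>2 * z\<^sup>2) + 3 * d\<^sup>2
    + 18 * (\<bar>z\<bar> * b\<^sup>2) + 512 * b ^ 4"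
    using cz dr crz zr r2 by linarith
  finally have "(z + \<sigma> * c * z - \<sigma> * d + r)\<^sup>2 \<le> \<dots>" .
  moreover have "0 \<le> c\<^sup>2 * z\<^sup>2" by simp
  ultimately show ?thesis by linarith
qed

text \<open>
  Per sign vector: the coordinate follows the increment \<open>\<beta>\<close> unless that is dangerous (event \<open>B\<close>),
  and additionally expands or contracts the discrepancy \<open>z\<close> by a factor \<open>1 \<plusminus> c\<close>, except on \<open>N\<close>,
  where \<open>z\<close> is dominated by a large value of \<open>X\<close> and the coordinate is frozen.
\<close>

lemma game_move_pointwise:
  fixes s X \<beta> c :: real
  assumes s: "\<bar>s\<bar> < 1" and c: "\<bar>c\<bar> \<le> 1 / 8"
  defines "v \<equiv> saturate_inv s"
  defines "z \<equiv> v - X"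
  defines "N \<equiv> \<bar>X\<bar> > 1 / 16 + \<bar>v\<bar>"
  defines "B \<equiv> N \<or> \<bar>\<beta>\<bar> > 1 / 16"
  shows "\<exists>\<eta>. \<forall>\<sigma>\<in>{1, -1}. \<bar>s + \<sigma> * \<eta>\<bar> < 1 \<and>
    (saturate_inv (s + \<sigma> * \<eta>) - (X + \<sigma> * \<beta>))\<^sup>2 \<le> z\<^sup>2 + 2 * \<sigma> * (c * (z\<^sup>2 * of_bool (\<not> N)) - z * \<beta> * of_bool B)
      + 33 * (c\<^sup>2 * z\<^sup>2) + 3 * (\<beta>\<^sup>2 * of_bool B) + 18 * (\<bar>z\<bar> * \<beta>\<^sup>2) + 512 * \<beta> ^ 4"
proof (cases N)
  case True
  show ?thesis
  proof (intro exI[of _ 0] ballI conjI)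
    fix \<sigma> :: real assume \<sigma>: "\<sigma> \<in> {1, -1}"
    show "\<bar>s + \<sigma> * 0\<bar> < 1" using s by simp
    have "(z - \<sigma> * \<beta>)\<^sup>2 = z\<^sup>2 - 2 * \<sigma> * (z * \<beta>) + \<beta>\<^sup>2"
      using \<sigma> by (auto simp: power2_eq_square algebra_simps)
    moreover have "0 \<le> 33 * (c\<^sup>2 * z\<^sup>2)" "0 \<le> 18 * (\<bar>z\<bar> * \<beta>\<^sup>2)" "0 \<le> 512 * \<beta> ^ 4" "0 \<le> \<beta>\<^sup>2" by auto
    ultimately have "(z - \<sigma> * \<beta>)\<^sup>2 \<le> z\<^sup>2 - 2 * \<sigma> * (z * \<beta>)
      + 33 * (c\<^sup>2 * z\<^sup>2) + 3 * \<beta>\<^sup>2 + 18 * (\<bar>z\<bar> * \<beta>\<^sup>2) + 512 * \<beta> ^ 4"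
      by linarith
    then show "(saturate_inv (s + \<sigma> * 0) - (X + \<sigma> * \<beta>))\<^sup>2 \<le> z\<^sup>2 + 2 * \<sigma> * (c * (z\<^sup>2 * of_bool (\<not> N)) - z * \<beta> * of_bool B)
      + 33 * (c\<^sup>2 * z\<^sup>2) + 3 * (\<beta>\<^sup>2 * of_bool B) + 18 * (\<bar>z\<bar> * \<beta>\<^sup>2) + 512 * \<beta> ^ 4"
      using True by (simp add: B_def z_def v_def algebra_simps)
  qed
next
  case False
  \<comment> \<open>\<open>b\<close> is the part of the increment that is followed, \<open>d\<close>
    the part that is skipped and charged to the error.\<close>
  define b where "b = (if B then 0 else \<beta>)"
  define d where "d = (if B then \<beta> else 0)"
  define h where "h = c * z + b"
  have X: "\<bar>X\<bar> \<le> 1 / 16 + \<bar>v\<bar>" using False by (simp add: N_def)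
  then have z: "\<bar>z\<bar> \<le> 2 * \<bar>v\<bar> + 1 / 16" unfolding z_def by linarith
  have "\<bar>b\<bar> \<le> 1 / 16" by (auto simp: b_def B_def)
  moreover have "\<bar>c * z\<bar> \<le> (1 / 8) * (2 * \<bar>v\<bar> + 1 / 16)"
    unfolding abs_mult using c z by (intro mult_mono) auto
  \<comment> \<open>The thresholds fit the range of \<open>saturate_inv_shift\<close>: 1/16 plus 1/8
    times \<open>2 * \<bar>v\<bar> + 1 / 16\<close> is below
    \<open>1 / 8 + \<bar>v\<bar> / 4\<close>.\<close>
  ultimately have "\<bar>h\<bar> \<le> 1 / 8 + \<bar>v\<bar> / 4"
    unfolding h_def using abs_triangle_ineq[of "c * z" b] by argo
  then obtain \<eta> k where k: "0 \<le> k" "k \<le> 4" "\<bar>v\<bar> * k \<le> 2" "k * \<bar>h\<bar> \<le> 1"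
    and \<eta>: "\<And>\<sigma>. \<sigma> \<in> {1, -1} \<Longrightarrow> \<bar>s + \<sigma> * \<eta>\<bar> < 1"
    "\<And>\<sigma>. \<sigma> \<in> {1, -1} \<Longrightarrow> \<bar>saturate_inv (s + \<sigma> * \<eta>) - v - \<sigma> * h\<bar> \<le> k * h\<^sup>2"
    unfolding v_def using saturate_inv_shift[OF s] by metis
  show ?thesis
  proof (intro exI[of _ \<eta>] ballI conjI \<eta>(1))
    fix \<sigma> :: real assume \<sigma>: "\<sigma> \<in> {1, -1}"
    define r where "r = saturate_inv (s + \<sigma> * \<eta>) - v - \<sigma> * h"
    have "saturate_inv (s + \<sigma> * \<eta>) - (X + \<sigma> * \<beta>) = z + \<sigma> * c * z - \<sigma> * d + r"
      by (simp add: r_def z_def h_def b_def d_def algebra_simps)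
    moreover have "\<bar>r\<bar> \<le> k * h\<^sup>2" using \<eta>(2)[OF \<sigma>] by (simp add: r_def)
    note compensated_move_square[OF k this z c h_def \<sigma>, of d]
    moreover have "\<bar>z\<bar> * b\<^sup>2 \<le> \<bar>z\<bar> * \<beta>\<^sup>2" "b ^ 4 \<le> \<beta> ^ 4" by (auto simp: b_def)
    moreover have "z * d = z * \<beta> * of_bool B" "d\<^sup>2 = \<beta>\<^sup>2 * of_bool B" by (auto simp: d_def)
    ultimately show "(saturate_inv (s + \<sigma> * \<eta>) - (X + \<sigma> * \<beta>))\<^sup>2 \<le> z\<^sup>2 + 2 * \<sigma> * (c * (z\<^sup>2 * of_bool (\<not> N)) - z * \<beta> * of_bool B)
      + 33 * (c\<^sup>2 * z\<^sup>2) + 3 * (\<beta>\<^sup>2 * of_bool B) + 18 * (\<bar>z\<bar> * \<beta>\<^sup>2) + 512 * \<beta> ^ 4"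
      using False by simp
  qed
qed

section \<open>One step of the game\<close>

text \<open>Empty and infinite \<open>\<Omega>\<close> give 0 by the conventions for sums and
  division, so linearity and monotonicity hold unconditionally.\<close>

definition mean :: "'a set \<Rightarrow> ('a \<Rightarrow> real) \<Rightarrow> real" where
  "mean \<Omega> f = (\<Sum>\<omega>\<in>\<Omega>. f \<omega>) / real (card \<Omega>)"

lemma mean_add: "mean \<Omega> (\<lambda>\<omega>. f \<omega> + g \<omega>) = mean \<Omega> f + mean \<Omega> g"
  by (simp add: mean_def sum.distrib add_divide_distrib)

lemma mean_diff: "mean \<Omega> (\<lambda>\<omega>. f \<omega> - g \<omega>) = mean \<Omega> f - mean \<Omega> g"
  by (simp add: mean_def sum_subtractf diff_divide_distrib)

lemma mean_cmult: "mean \<Omega> (\<lambda>\<omega>. c * f \<omega>) = c * mean \<Omega> f"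
  by (simp add: mean_def sum_distrib_left)

lemma mean_sum: "mean \<Omega> (\<lambda>\<omega>. \<Sum>i\<in>I. f i \<omega>) = (\<Sum>i\<in>I. mean \<Omega> (f i))"
  unfolding mean_def by (subst sum.swap) (simp add: sum_divide_distrib)

lemma mean_mono: "(\<And>\<omega>. \<omega> \<in> \<Omega> \<Longrightarrow> f \<omega> \<le> g \<omega>) \<Longrightarrow> mean \<Omega> f \<le> mean \<Omega> g"
  by (simp add: mean_def divide_right_mono sum_mono)

lemma mean_nonneg: "(\<And>\<omega>. \<omega> \<in> \<Omega> \<Longrightarrow> 0 \<le> f \<omega>) \<Longrightarrow> 0 \<le> mean \<Omega> f"
  by (simp add: mean_def sum_nonneg)

lemma mean_cong: "(\<And>\<omega>. \<omega> \<in> \<Omega> \<Longrightarrow> f \<omega> = g \<omega>) \<Longrightarrow> mean \<Omega> f = mean \<Omega> g"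
  by (simp add: mean_def)

lemma mean_Cauchy_Schwarz:
  "(mean \<Omega> (\<lambda>\<omega>. f \<omega> * g \<omega>))\<^sup>2 \<le> mean \<Omega> (\<lambda>\<omega>. (f \<omega>)\<^sup>2) * mean \<Omega> (\<lambda>\<omega>. (g \<omega>)\<^sup>2)"
  unfolding mean_def power_divide times_divide_times_eq power2_eq_square[of "real (card \<Omega>)"]
  by (intro divide_right_mono Cauchy_Schwarz_ineq_sum) auto

text \<open>
  The opponent announces \<open>\<beta>\<close> and chooses the sign \<open>\<sigma>\<close> only after \<open>\<eta>\<close> has been played. The
  coefficient \<open>c\<close> is chosen so that the first-order change of the mean square discrepancy equals
  that of \<open>p * V\<close>, for both signs; the second-order gain \<open>p * W\<close> of \<open>p * V\<close> then pays
  for all second-order errors. If too little discrepancy lives outside \<open>N\<close> to steer with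
  (\<open>M < U / 2\<close>), there is enough slack to play \<open>c = 0\<close>.
\<close>

lemma game_step:
  fixes X \<beta> s :: "'a \<Rightarrow> real" and \<Omega> :: "'a set" and u p \<theta> :: real
  assumes s: "\<And>\<omega>. \<omega> \<in> \<Omega> \<Longrightarrow> \<bar>s \<omega>\<bar> < 1"
  defines "u \<equiv> 1 / 100" and "p \<equiv> 1 / 10 ^ 6" and "\<theta> \<equiv> 1 / 10 ^ 11"
  defines "V \<equiv> mean \<Omega> (\<lambda>\<omega>. (X \<omega>)\<^sup>2)" and "W \<equiv> mean \<Omega> (\<lambda>\<omega>. (\<beta> \<omega>)\<^sup>2)"
  assumes VW: "V + W \<le> \<theta>\<^sup>2"
    and X4: "mean \<Omega> (\<lambda>\<omega>. X \<omega> ^ 4) \<le> 3 * V\<^sup>2"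
    and \<beta>4: "mean \<Omega> (\<lambda>\<omega>. \<beta> \<omega> ^ 4) \<le> 3 * W\<^sup>2"
    and inv: "mean \<Omega> (\<lambda>\<omega>. (saturate_inv (s \<omega>) - X \<omega>)\<^sup>2) \<le> u * \<theta>\<^sup>2 + p * V"
  shows "\<exists>\<eta>. \<forall>\<sigma>\<in>{1, -1}. (\<forall>\<omega>\<in>\<Omega>. \<bar>s \<omega> + \<sigma> * \<eta> \<omega>\<bar> < 1) \<and>
    mean \<Omega> (\<lambda>\<omega>. (saturate_inv (s \<omega> + \<sigma> * \<eta> \<omega>) - (X \<omega> + \<sigma> * \<beta> \<omega>))\<^sup>2)
      \<le> u * \<theta>\<^sup>2 + p * mean \<Omega> (\<lambda>\<omega>. (X \<omega> + \<sigma> * \<beta> \<omega>)\<^sup>2)"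
proof -
  define v where "v \<omega> = saturate_inv (s \<omega>)" for \<omega>
  define z where "z \<omega> = v \<omega> - X \<omega>" for \<omega>
  define N where "N \<omega> \<longleftrightarrow> \<bar>X \<omega>\<bar> > 1 / 16 + \<bar>v \<omega>\<bar>" for \<omega>
  define B where "B \<omega> \<longleftrightarrow> N \<omega> \<or> \<bar>\<beta> \<omega>\<bar> > 1 / 16" for \<omega>
  define m where "m = mean \<Omega> (\<lambda>\<omega>. (z \<omega>)\<^sup>2)"
  define M where "M = mean \<Omega> (\<lambda>\<omega>. (z \<omega>)\<^sup>2 * of_bool (\<not> N \<omega>))"
  define e where "e = mean \<Omega> (\<lambda>\<omega>. z \<omega> * \<beta> \<omega> * of_bool (B \<omega>))"
  define Q where "Q = mean \<Omega> (\<lambda>\<omega>. (\<beta> \<omega>)\<^sup>2 * of_bool (B \<omega>))"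
  define R where "R = mean \<Omega> (\<lambda>\<omega>. \<bar>z \<omega>\<bar> * (\<beta> \<omega>)\<^sup>2)"
  define \<gamma> where "\<gamma> = mean \<Omega> (\<lambda>\<omega>. X \<omega> * \<beta> \<omega>)"
  define U where "U = u * \<theta>\<^sup>2 + p * V"
  have pos: "0 \<le> V" "0 \<le> W" "0 \<le> m" "0 \<le> M" "0 \<le> Q" "0 \<le> R"
    unfolding V_def W_def m_def M_def Q_def R_def by (auto intro!: mean_nonneg)
  have pos4: "0 \<le> mean \<Omega> (\<lambda>\<omega>. \<beta> \<omega> ^ 4)" by (simp add: mean_nonneg)
  have VW': "V \<le> \<theta>\<^sup>2" "W \<le> \<theta>\<^sup>2" using VW pos by auto
  have \<theta>: "\<theta> > 0" "\<theta>\<^sup>2 > 0" by (auto simp: \<theta>_def)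
  have mU: "m \<le> U" using inv by (simp add: m_def z_def v_def U_def)
  have U: "u * \<theta>\<^sup>2 \<le> U" "U \<le> \<theta>\<^sup>2 / 50"
    using VW' pos \<theta> by (auto simp: U_def u_def p_def)
  have WW: "W\<^sup>2 \<le> \<theta>\<^sup>2 * W" "W\<^sup>2 \<le> \<theta> * W"
  proof -
    show A: "W\<^sup>2 \<le> \<theta>\<^sup>2 * W" using VW' pos by (simp add: power2_eq_square mult_right_mono)
    have "\<theta>\<^sup>2 * W \<le> \<theta> * W" using pos by (intro mult_right_mono) (auto simp: \<theta>_def power2_eq_square)
    with A show "W\<^sup>2 \<le> \<theta> * W" by simp
  qed
  \<comment> \<open>Cauchy-Schwarz splits off \<open>m\<close>, which is small, and the fourth
    moment of \<open>\<beta>\<close>, which is comparable to \<open>W\<^sup>2\<close>.\<close>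
  have R: "R \<le> \<theta> * W"
  proof -
    have "R\<^sup>2 \<le> m * mean \<Omega> (\<lambda>\<omega>. ((\<beta> \<omega>)\<^sup>2)\<^sup>2)"
      using mean_Cauchy_Schwarz[of \<Omega> "\<lambda>\<omega>. \<bar>z \<omega>\<bar>" "\<lambda>\<omega>. (\<beta> \<omega>)\<^sup>2"] by (simp add: R_def m_def)
    also have "\<dots> \<le> (\<theta>\<^sup>2 / 50) * (3 * W\<^sup>2)"
      using mU U \<beta>4 pos pos4 by (intro mult_mono) (auto simp flip: power_mult)
    also have "\<dots> \<le> (\<theta> * W)\<^sup>2" by (simp add: power_mult_distrib)
    finally show ?thesis using \<theta> pos by (auto intro: power2_le_imp_le)
  qed
  have "mean \<Omega> (\<lambda>\<omega>. (\<beta> \<omega>)\<^sup>2 * \<bar>X \<omega>\<bar>) \<le> 2 * (\<theta> * W)"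
  proof -
    have "(mean \<Omega> (\<lambda>\<omega>. (\<beta> \<omega>)\<^sup>2 * \<bar>X \<omega>\<bar>))\<^sup>2 \<le> mean \<Omega> (\<lambda>\<omega>. ((\<beta> \<omega>)\<^sup>2)\<^sup>2) * V"
      using mean_Cauchy_Schwarz[of \<Omega> "\<lambda>\<omega>. (\<beta> \<omega>)\<^sup>2" "\<lambda>\<omega>. \<bar>X \<omega>\<bar>"] by (simp add: V_def)
    also have "\<dots> \<le> (3 * W\<^sup>2) * \<theta>\<^sup>2"
      using \<beta>4 VW' pos pos4 by (intro mult_mono) (auto simp flip: power_mult)
    also have "\<dots> \<le> (2 * (\<theta> * W))\<^sup>2" by (simp add: power_mult_distrib)
    finally show ?thesis using \<theta> pos by (auto intro: power2_le_imp_le)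
  qed
  \<comment> \<open>A Markov-type bound for the event \<open>B\<close>: on \<open>N\<close> one has
    \<open>1 \<le> 16 * \<bar>X \<omega>\<bar>\<close>, and
    \<open>\<bar>\<beta> \<omega>\<bar> > 1 / 16\<close> gives
    \<open>1 \<le> 256 * (\<beta> \<omega>)\<^sup>2\<close>.\<close>
  moreover have "Q \<le> mean \<Omega> (\<lambda>\<omega>. 16 * ((\<beta> \<omega>)\<^sup>2 * \<bar>X \<omega>\<bar>) + 256 * \<beta> \<omega> ^ 4)"
    unfolding Q_def
  proof (rule mean_mono)
    fix \<omega>
    have *: "(\<beta> \<omega>)\<^sup>2 * (\<beta> \<omega>)\<^sup>2 = \<beta> \<omega> ^ 4" by (simp flip: power_add)
    have "(\<beta> \<omega>)\<^sup>2 * 1 \<le> (\<beta> \<omega>)\<^sup>2 * (16 * \<bar>X \<omega>\<bar>)" if "N \<omega>"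
      using that by (intro mult_left_mono) (auto simp: N_def)
    then have "(\<beta> \<omega>)\<^sup>2 \<le> 16 * ((\<beta> \<omega>)\<^sup>2 * \<bar>X \<omega>\<bar>)" if "N \<omega>"
      using that by (simp only: mult.left_commute mult_1_right)
    moreover have "(\<beta> \<omega>)\<^sup>2 \<le> 256 * \<beta> \<omega> ^ 4" if "\<bar>\<beta> \<omega>\<bar> > 1 / 16"
    proof -
      have "(1 / 16)\<^sup>2 \<le> \<bar>\<beta> \<omega>\<bar>\<^sup>2" using that by (intro power_mono) auto
      then have "1 \<le> 256 * (\<beta> \<omega>)\<^sup>2" by (simp add: power2_eq_square)
      then have "(\<beta> \<omega>)\<^sup>2 * 1 \<le> (\<beta> \<omega>)\<^sup>2 * (256 * (\<beta> \<omega>)\<^sup>2)" by (rule mult_left_mono) simp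
      then show ?thesis unfolding *[symmetric] by (simp only: mult.left_commute mult_1_right)
    qed
    moreover have "0 \<le> (\<beta> \<omega>)\<^sup>2 * \<bar>X \<omega>\<bar>" "0 \<le> \<beta> \<omega> ^ 4" by auto
    ultimately show "(\<beta> \<omega>)\<^sup>2 * of_bool (B \<omega>) \<le> 16 * ((\<beta> \<omega>)\<^sup>2 * \<bar>X \<omega>\<bar>) + 256 * \<beta> \<omega> ^ 4"
      unfolding B_def by (cases "N \<omega>"; cases "\<bar>\<beta> \<omega>\<bar> > 1 / 16"; simp; linarith)
  qed
  ultimately have Q: "Q \<le> 33 * (\<theta> * W)"
  proof -
    have "\<theta>\<^sup>2 * W \<le> \<theta> * W / 100000" using pos by (simp add: \<theta>_def power2_eq_square)
    moreover have "0 \<le> \<theta> * W" using pos \<theta> by simp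
    moreover assume "mean \<Omega> (\<lambda>\<omega>. (\<beta> \<omega>)\<^sup>2 * \<bar>X \<omega>\<bar>) \<le> 2 * (\<theta> * W)"
      "Q \<le> mean \<Omega> (\<lambda>\<omega>. 16 * ((\<beta> \<omega>)\<^sup>2 * \<bar>X \<omega>\<bar>) + 256 * \<beta> \<omega> ^ 4)"
    ultimately show ?thesis
      using \<beta>4 WW(1) unfolding mean_add mean_cmult by linarith
  qed
  \<comment> \<open>On \<open>N\<close> the discrepancy is at most
    \<open>2 * \<bar>X \<omega>\<bar>\<close>, and \<open>\<bar>X \<omega>\<bar> > 1 / 16\<close>
    raises this to \<open>32 * (X \<omega>)\<^sup>2\<close>; so the part of \<open>m\<close> living
    on \<open>N\<close> is controlled by the fourth moment of \<open>X\<close>.\<close>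
  have mM: "m - M \<le> 3072 * (\<theta>\<^sup>2 * \<theta>\<^sup>2)"
  proof -
    have "m - M \<le> mean \<Omega> (\<lambda>\<omega>. 1024 * X \<omega> ^ 4)"
      unfolding m_def M_def mean_diff[symmetric]
    proof (rule mean_mono)
      fix \<omega>
      show "(z \<omega>)\<^sup>2 - (z \<omega>)\<^sup>2 * of_bool (\<not> N \<omega>) \<le> 1024 * X \<omega> ^ 4"
      proof (cases "N \<omega>")
        case True
        then have X: "1 / 16 \<le> \<bar>X \<omega>\<bar>" "\<bar>v \<omega>\<bar> \<le> \<bar>X \<omega>\<bar>" by (auto simp: N_def)
        have "\<bar>z \<omega>\<bar> \<le> 2 * \<bar>X \<omega>\<bar> * 1" using X(2) unfolding z_def by linarith
        also have "\<dots> \<le> 2 * \<bar>X \<omega>\<bar> * (16 * \<bar>X \<omega>\<bar>)" using X(1) by (intro mult_left_mono) auto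
        also have "\<dots> = \<bar>32 * (X \<omega>)\<^sup>2\<bar>" by (simp add: power2_eq_square abs_mult)
        finally have "\<bar>z \<omega>\<bar> \<le> \<bar>32 * (X \<omega>)\<^sup>2\<bar>" .
        then have "(z \<omega>)\<^sup>2 \<le> (32 * (X \<omega>)\<^sup>2)\<^sup>2"
          by (simp only: abs_le_square_iff)
        then show ?thesis using True by (simp add: power_mult_distrib flip: power_mult)
      qed simp
    qed
    also have "\<dots> \<le> 1024 * (3 * V\<^sup>2)" using X4 by (simp add: mean_cmult)
    also have "V\<^sup>2 \<le> \<theta>\<^sup>2 * \<theta>\<^sup>2" unfolding power2_eq_square[of V] using VW' pos by (intro mult_mono) auto
    finally show ?thesis by simp
  qed
  have of_bool_sq: "(of_bool b :: real)\<^sup>2 = of_bool b" for b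
    by (cases b) auto
  have e2: "e\<^sup>2 \<le> m * Q"
    using mean_Cauchy_Schwarz[of \<Omega> "z" "\<lambda>\<omega>. \<beta> \<omega> * of_bool (B \<omega>)"]
    by (simp add: e_def m_def Q_def power_mult_distrib mult.assoc of_bool_sq)
  have \<gamma>2: "\<gamma>\<^sup>2 \<le> V * W"
    using mean_Cauchy_Schwarz[of \<Omega> X \<beta>] by (simp add: \<gamma>_def V_def W_def)
  \<comment> \<open>The pointwise moves averaged over \<open>\<Omega>\<close>. The second-order
    terms \<open>3 * Q\<close>, \<open>18 * R\<close> and the fourth moment of
    \<open>\<beta>\<close> add up to at most \<open>120 * (\<theta> * W)\<close>, from 99 + 18 plus
    a negligible rest.\<close>
  have move: "\<exists>\<eta>. \<forall>\<sigma>\<in>{1, -1}. (\<forall>\<omega>\<in>\<Omega>. \<bar>s \<omega> + \<sigma> * \<eta> \<omega>\<bar> < 1) \<and>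
    mean \<Omega> (\<lambda>\<omega>. (saturate_inv (s \<omega> + \<sigma> * \<eta> \<omega>) - (X \<omega> + \<sigma> * \<beta> \<omega>))\<^sup>2)
      \<le> m + 2 * \<sigma> * (c * M - e) + 33 * (c\<^sup>2 * m) + 120 * (\<theta> * W)" if c: "\<bar>c\<bar> \<le> 1 / 8" for c
  proof -
    have "\<forall>\<omega>. \<exists>\<eta>. \<omega> \<in> \<Omega> \<longrightarrow> (\<forall>\<sigma>\<in>{1, -1}. \<bar>s \<omega> + \<sigma> * \<eta>\<bar> < 1 \<and>
      (saturate_inv (s \<omega> + \<sigma> * \<eta>) - (X \<omega> + \<sigma> * \<beta> \<omega>))\<^sup>2
        \<le> (z \<omega>)\<^sup>2 + 2 * \<sigma> * (c * ((z \<omega>)\<^sup>2 * of_bool (\<not> N \<omega>)) - z \<omega> * \<beta> \<omega> * of_bool (B \<omega>))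
      + 33 * (c\<^sup>2 * (z \<omega>)\<^sup>2) + 3 * ((\<beta> \<omega>)\<^sup>2 * of_bool (B \<omega>)) + 18 * (\<bar>z \<omega>\<bar> * (\<beta> \<omega>)\<^sup>2) + 512 * \<beta> \<omega> ^ 4)"
      using game_move_pointwise[OF s c] unfolding z_def v_def N_def B_def by blast
    then obtain \<eta> where \<eta>: "\<And>\<omega> \<sigma>. \<omega> \<in> \<Omega> \<Longrightarrow> \<sigma> \<in> {1, -1} \<Longrightarrow> \<bar>s \<omega> + \<sigma> * \<eta> \<omega>\<bar> < 1"
      "\<And>\<omega> \<sigma>. \<omega> \<in> \<Omega> \<Longrightarrow> \<sigma> \<in> {1, -1} \<Longrightarrow> (saturate_inv (s \<omega> + \<sigma> * \<eta> \<omega>) - (X \<omega> + \<sigma> * \<beta> \<omega>))\<^sup>2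
        \<le> (z \<omega>)\<^sup>2 + 2 * \<sigma> * (c * ((z \<omega>)\<^sup>2 * of_bool (\<not> N \<omega>)) - z \<omega> * \<beta> \<omega> * of_bool (B \<omega>))
      + 33 * (c\<^sup>2 * (z \<omega>)\<^sup>2) + 3 * ((\<beta> \<omega>)\<^sup>2 * of_bool (B \<omega>)) + 18 * (\<bar>z \<omega>\<bar> * (\<beta> \<omega>)\<^sup>2) + 512 * \<beta> \<omega> ^ 4"
      by metis
    show ?thesis
    proof (intro exI[of _ \<eta>] ballI conjI \<eta>(1))
      fix \<sigma> :: real assume \<sigma>: "\<sigma> \<in> {1, -1}"
      have "mean \<Omega> (\<lambda>\<omega>. (saturate_inv (s \<omega> + \<sigma> * \<eta> \<omega>) - (X \<omega> + \<sigma> * \<beta> \<omega>))\<^sup>2)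
        \<le> m + 2 * \<sigma> * (c * M - e) + 33 * (c\<^sup>2 * m) + 3 * Q + 18 * R + 512 * mean \<Omega> (\<lambda>\<omega>. \<beta> \<omega> ^ 4)"
        using mean_mono[OF \<eta>(2)[OF _ \<sigma>], of \<Omega>]
        unfolding mean_add mean_diff mean_cmult m_def M_def e_def Q_def R_def by simp
      moreover have "512 * (3 * W\<^sup>2) \<le> 512 * (3 * (\<theta>\<^sup>2 * W))" using WW by simp
      moreover have "\<theta>\<^sup>2 * W \<le> \<theta> * W / 100000" using pos by (simp add: \<theta>_def power2_eq_square)
      moreover have "0 \<le> \<theta> * W" using pos \<theta> by simp
      ultimately show "mean \<Omega> (\<lambda>\<omega>. (saturate_inv (s \<omega> + \<sigma> * \<eta> \<omega>) - (X \<omega> + \<sigma> * \<beta> \<omega>))\<^sup>2)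
        \<le> m + 2 * \<sigma> * (c * M - e) + 33 * (c\<^sup>2 * m) + 120 * (\<theta> * W)"
        using \<beta>4 Q R by linarith
    qed
  qed
  have sq: "mean \<Omega> (\<lambda>\<omega>. (X \<omega> + \<sigma> * \<beta> \<omega>)\<^sup>2) = V + 2 * \<sigma> * \<gamma> + W" if "\<sigma> \<in> {1, -1}" for \<sigma>
  proof -
    have "mean \<Omega> (\<lambda>\<omega>. (X \<omega> + \<sigma> * \<beta> \<omega>)\<^sup>2) = mean \<Omega> (\<lambda>\<omega>. (X \<omega>)\<^sup>2 + 2 * \<sigma> * (X \<omega> * \<beta> \<omega>) + (\<beta> \<omega>)\<^sup>2)"
      using that by (intro mean_cong) (auto simp: power2_eq_square algebra_simps)
    then show ?thesis unfolding mean_add mean_cmult V_def W_def \<gamma>_def .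
  qed
  show ?thesis
  proof (cases "M \<ge> U / 2")
    case True
    define c where "c = (p * \<gamma> + e) / M"
    have Upos: "U > 0" using less_le_trans[OF mult_pos_pos[OF _ \<theta>(2)] U(1)] by (simp add: u_def)
    then have Mpos: "M > 0" using True by simp
    have M2: "c * M = p * \<gamma> + e" using Mpos by (simp add: c_def)
    have "(p * \<gamma> + e)\<^sup>2 \<le> 2 * (p\<^sup>2 * \<gamma>\<^sup>2) + 2 * e\<^sup>2"
      unfolding power2_sum power_mult_distrib
      using sum_squares_bound[of "p * \<gamma>" e, unfolded power_mult_distrib] by linarith
    also have "\<dots> \<le> 2 * (p\<^sup>2 * (\<theta>\<^sup>2 * W)) + 2 * (U * (33 * (\<theta> * W)))"
    proof -
      have "\<gamma>\<^sup>2 \<le> \<theta>\<^sup>2 * W" using \<gamma>2 mult_right_mono[OF VW'(1) pos(2)] by linarith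
      then have "p\<^sup>2 * \<gamma>\<^sup>2 \<le> p\<^sup>2 * (\<theta>\<^sup>2 * W)" by (intro mult_left_mono) auto
      moreover have "m * Q \<le> U * (33 * (\<theta> * W))" using mU Q pos by (intro mult_mono) auto
      ultimately show ?thesis using e2 by linarith
    qed
    also have "\<dots> \<le> U * W * (2 * p\<^sup>2 / u + 66 * \<theta>)"
    proof -
      have "p\<^sup>2 / u * W * (u * \<theta>\<^sup>2) \<le> p\<^sup>2 / u * W * U"
        using U pos by (intro mult_left_mono) (auto simp: u_def)
      then have "p\<^sup>2 * (\<theta>\<^sup>2 * W) \<le> p\<^sup>2 / u * W * U" by (simp add: u_def mult_ac)
      moreover have "U * W * (2 * p\<^sup>2 / u + 66 * \<theta>) = 2 * (p\<^sup>2 / u * W * U) + 2 * (U * (33 * (\<theta> * W)))"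
        by (simp add: algebra_simps)
      ultimately show ?thesis by linarith
    qed
    finally have num: "(c * M)\<^sup>2 \<le> U * W * (2 * p\<^sup>2 / u + 66 * \<theta>)" by (simp add: M2)
    \<comment> \<open>Dividing by \<open>M\<^sup>2 \<ge> (U / 2)\<^sup>2\<close> will give
      \<open>c\<^sup>2 * U \<le> 4 * \<kappa> * W\<close>. The steering cost
      \<open>33 * (c\<^sup>2 * m)\<close> must fit into the gain \<open>p * W\<close>; as
      \<open>\<kappa>\<close> contains \<open>p\<^sup>2 / u\<close>, this is why \<open>p\<close> is
      taken much smaller than \<open>u\<close>, and \<open>\<theta>\<close> much smaller than
      \<open>p\<close>.\<close>
    define \<kappa> where "\<kappa> = 2 * p\<^sup>2 / u + 66 * \<theta>"
    have \<kappa>: "\<kappa> = 2 / 10 ^ 10 + 66 / 10 ^ 11" by (simp add: \<kappa>_def p_def u_def \<theta>_def power2_eq_square)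
    have "c\<^sup>2 * (U / 2)\<^sup>2 \<le> c\<^sup>2 * M\<^sup>2" using True Upos by (intro mult_left_mono power_mono) auto
    then have "c\<^sup>2 * (U / 2)\<^sup>2 \<le> U * W * \<kappa>" using num by (simp add: power_mult_distrib \<kappa>_def)
    moreover have "c\<^sup>2 * U * U = 4 * (c\<^sup>2 * (U / 2)\<^sup>2)" by (simp add: power2_eq_square)
    moreover have "4 * \<kappa> * W * U = 4 * (U * W * \<kappa>)" by (simp add: mult_ac)
    ultimately have "c\<^sup>2 * U * U \<le> 4 * \<kappa> * W * U" by linarith
    then have c2U: "c\<^sup>2 * U \<le> 4 * \<kappa> * W" using Upos by (simp add: mult_le_cancel_right)
    have "c\<^sup>2 \<le> (1 / 8)\<^sup>2"
    proof -
      have "c\<^sup>2 * (u * \<theta>\<^sup>2) \<le> c\<^sup>2 * U" using U by (intro mult_left_mono) auto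
      also have "\<dots> \<le> 4 * \<kappa> * \<theta>\<^sup>2" using c2U mult_left_mono[OF VW'(2), of "4 * \<kappa>"] by (simp add: \<kappa>)
      finally have "c\<^sup>2 * u \<le> 4 * \<kappa>" using \<theta> by (simp add: mult.assoc[symmetric] mult_le_cancel_right)
      then show ?thesis by (simp add: \<kappa> u_def power2_eq_square)
    qed
    then have c: "\<bar>c\<bar> \<le> 1 / 8" by (simp add: abs_le_square_iff[symmetric])
    have c2m: "c\<^sup>2 * m \<le> 4 * \<kappa> * W" using mult_left_mono[OF mU, of "c\<^sup>2"] c2U by simp
    obtain \<eta> where \<eta>: "\<forall>\<sigma>\<in>{1, -1}. (\<forall>\<omega>\<in>\<Omega>. \<bar>s \<omega> + \<sigma> * \<eta> \<omega>\<bar> < 1) \<and>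
      mean \<Omega> (\<lambda>\<omega>. (saturate_inv (s \<omega> + \<sigma> * \<eta> \<omega>) - (X \<omega> + \<sigma> * \<beta> \<omega>))\<^sup>2)
      \<le> m + 2 * \<sigma> * (c * M - e) + 33 * (c\<^sup>2 * m) + 120 * (\<theta> * W)"
      using move[OF c] by blast
    show ?thesis
    proof (intro exI[of _ \<eta>] ballI conjI)
      fix \<sigma> :: real assume \<sigma>: "\<sigma> \<in> {1, -1}"
      show "\<bar>s \<omega> + \<sigma> * \<eta> \<omega>\<bar> < 1" if "\<omega> \<in> \<Omega>" for \<omega> using \<eta> \<sigma> that by blast
      have "33 * (4 * \<kappa> * W) + 120 * (\<theta> * W) \<le> p * W"
        using pos by (simp add: \<kappa> p_def \<theta>_def)
      moreover have "c * M - e = p * \<gamma>" by (simp add: M2)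
      moreover have "p * (V + 2 * \<sigma> * \<gamma> + W) = p * V + 2 * \<sigma> * (p * \<gamma>) + p * W" by (simp add: algebra_simps)
      ultimately show "mean \<Omega> (\<lambda>\<omega>. (saturate_inv (s \<omega> + \<sigma> * \<eta> \<omega>) - (X \<omega> + \<sigma> * \<beta> \<omega>))\<^sup>2)
      \<le> u * \<theta>\<^sup>2 + p * mean \<Omega> (\<lambda>\<omega>. (X \<omega> + \<sigma> * \<beta> \<omega>)\<^sup>2)"
        using bspec[OF \<eta> \<sigma>] c2m mU unfolding sq[OF \<sigma>] U_def by simp
    qed
  next
    case False
    obtain \<eta> where \<eta>: "\<forall>\<sigma>\<in>{1, -1}. (\<forall>\<omega>\<in>\<Omega>. \<bar>s \<omega> + \<sigma> * \<eta> \<omega>\<bar> < 1) \<and>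
      mean \<Omega> (\<lambda>\<omega>. (saturate_inv (s \<omega> + \<sigma> * \<eta> \<omega>) - (X \<omega> + \<sigma> * \<beta> \<omega>))\<^sup>2)
      \<le> m + 2 * \<sigma> * (0 * M - e) + 33 * (0\<^sup>2 * m) + 120 * (\<theta> * W)"
      using move[of 0] by auto
    show ?thesis
    proof (intro exI[of _ \<eta>] ballI conjI)
      fix \<sigma> :: real assume \<sigma>: "\<sigma> \<in> {1, -1}"
      show "\<bar>s \<omega> + \<sigma> * \<eta> \<omega>\<bar> < 1" if "\<omega> \<in> \<Omega>" for \<omega> using \<eta> \<sigma> that by blast
      \<comment> \<open>With \<open>c = 0\<close> the first-order term \<open>e\<close> is not
        cancelled, but \<open>e\<^sup>2 \<le> m * Q\<close> is of order \<open>\<theta> ^ 5\<close>,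
        so \<open>e\<close> is negligible against the slack. The latter is of order
        \<open>u * \<theta>\<^sup>2\<close>, because \<open>m\<close> is at most
        \<open>U / 2\<close> plus a term of order \<open>\<theta> ^ 4\<close>.\<close>
      have "\<bar>e\<bar> \<le> \<theta>\<^sup>2 / 1000"
      proof -
        have "m * Q \<le> (\<theta>\<^sup>2 / 50) * (33 * (\<theta> * \<theta>\<^sup>2))"
        proof (rule mult_mono)
          have "\<theta> * W \<le> \<theta> * \<theta>\<^sup>2" using VW' \<theta> by (intro mult_left_mono) auto
          then show "Q \<le> 33 * (\<theta> * \<theta>\<^sup>2)" using Q by linarith
        qed (use mU U pos in auto)
        also have "\<dots> \<le> (\<theta>\<^sup>2 / 1000)\<^sup>2" by (simp add: \<theta>_def power2_eq_square)
        finally have "e\<^sup>2 \<le> (\<theta>\<^sup>2 / 1000)\<^sup>2" using e2 by linarith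
        then show ?thesis by (simp add: abs_le_square_iff[symmetric])
      qed
      then have "2 * \<sigma> * (0 * M - e) \<le> \<theta>\<^sup>2 / 500" using \<sigma> by auto
      moreover have "120 * (\<theta> * W) \<le> \<theta>\<^sup>2 / 1000"
      proof -
        have "\<theta> * W \<le> \<theta> * \<theta>\<^sup>2" using VW' \<theta> by (intro mult_left_mono) auto
        also have "\<theta> * \<theta>\<^sup>2 \<le> \<theta>\<^sup>2 / 1000000" by (simp add: \<theta>_def power2_eq_square)
        finally show ?thesis using \<theta>(2) by linarith
      qed
      moreover have "m \<le> (u * \<theta>\<^sup>2 + p * V) / 2 + 3072 * (\<theta>\<^sup>2 * \<theta>\<^sup>2)" using False mM unfolding U_def by linarith
      moreover have "3072 * (\<theta>\<^sup>2 * \<theta>\<^sup>2) \<le> \<theta>\<^sup>2 / 10000" "u * \<theta>\<^sup>2 = \<theta>\<^sup>2 / 100" "p * V \<le> \<theta>\<^sup>2 / 10000"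
        using VW' by (simp_all add: \<theta>_def u_def p_def power2_eq_square)
      moreover have "0 \<le> p * mean \<Omega> (\<lambda>\<omega>. (X \<omega> + \<sigma> * \<beta> \<omega>)\<^sup>2)"
        by (simp add: p_def mean_nonneg)
      ultimately show "mean \<Omega> (\<lambda>\<omega>. (saturate_inv (s \<omega> + \<sigma> * \<eta> \<omega>) - (X \<omega> + \<sigma> * \<beta> \<omega>))\<^sup>2)
      \<le> u * \<theta>\<^sup>2 + p * mean \<Omega> (\<lambda>\<omega>. (X \<omega> + \<sigma> * \<beta> \<omega>)\<^sup>2)"
        using conjunct2[OF bspec[OF \<eta> \<sigma>]] \<theta>(2)
        by (simp only: power_zero_numeral mult_zero_left mult_zero_right add_0_right) argo
    qed
  qed
qed

section \<open>Martingales on a binary tree\<close>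

text \<open>
  The node \<open>(d, a)\<close> of the binary tree stands for the block of leaves \<open>l\<close> with \<open>l div 2 ^ d = a\<close>;
  its children are \<open>(d - 1, 2 * a)\<close> and \<open>(d - 1, 2 * a + 1)\<close>.
\<close>

fun block_mean :: "(nat \<Rightarrow> 'a::real_vector) \<Rightarrow> nat \<Rightarrow> nat \<Rightarrow> 'a" where
  "block_mean f 0 a = f a"
| "block_mean f (Suc d) a = (1 / 2) *\<^sub>R (block_mean f d (2 * a) + block_mean f d (2 * a + 1))"

text \<open>\<open>T\<close> lists the nodes at which the martingale of block means must not move;
  with \<open>T\<close> read off from the Haar functions of \<open>A\<close>, this expresses
  annihilation of \<open>Y\<close>.\<close>

fun balanced :: "(nat \<times> nat) set \<Rightarrow> (nat \<Rightarrow> 'a::real_vector) \<Rightarrow> nat \<Rightarrow> nat \<Rightarrow> bool" where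
  "balanced T f 0 a \<longleftrightarrow> True"
| "balanced T f (Suc d) a \<longleftrightarrow> ((Suc d, a) \<in> T \<longrightarrow> block_mean f d (2 * a) = block_mean f d (2 * a + 1)) \<and>
    balanced T f d (2 * a) \<and> balanced T f d (2 * a + 1)"

lemma div_power_Suc_eq:
  "l div 2 ^ d = 2 * a \<Longrightarrow> l div 2 ^ Suc d = (a::nat)"
  "l div 2 ^ d = 2 * a + 1 \<Longrightarrow> l div 2 ^ Suc d = a"
  by (simp_all add: div_mult2_eq mult.commute[of 2])

lemma block_mean_cong:
  assumes "\<And>l. l div 2 ^ d = a \<Longrightarrow> f l = g l"
  shows "block_mean f d a = block_mean g d a"
  using assms
proof (induction d arbitrary: a)
  case (Suc d)
  have "block_mean f d (2 * a) = block_mean g d (2 * a)"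
    by (rule Suc.IH) (use Suc.prems div_power_Suc_eq(1) in blast)
  moreover have "block_mean f d (2 * a + 1) = block_mean g d (2 * a + 1)"
    by (rule Suc.IH) (use Suc.prems div_power_Suc_eq(2) in blast)
  ultimately show ?case by simp
qed simp

lemma balanced_cong:
  assumes "\<And>l. l div 2 ^ d = a \<Longrightarrow> f l = g l" "balanced T f d a"
  shows "balanced T g d a"
  using assms
proof (induction d arbitrary: a)
  case (Suc d)
  have eq: "f l = g l" if "l div 2 ^ d = 2 * a \<or> l div 2 ^ d = 2 * a + 1" for l
    using that Suc.prems(1) div_power_Suc_eq by blast
  have "block_mean f d (2 * a) = block_mean g d (2 * a)"
    "block_mean f d (2 * a + 1) = block_mean g d (2 * a + 1)"
    by (auto intro!: block_mean_cong eq)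
  moreover have "balanced T g d (2 * a)" "balanced T g d (2 * a + 1)"
    using Suc.prems(2) by (auto intro!: Suc.IH eq)
  ultimately show ?case using Suc.prems(2) by simp
qed simp

lemma block_mean_in_convex:
  assumes "convex D" "\<And>l. l div 2 ^ d = a \<Longrightarrow> f l \<in> D"
  shows "block_mean f d a \<in> D"
  using assms(2)
proof (induction d arbitrary: a)
  case (Suc d)
  have "block_mean f d (2 * a) \<in> D" "block_mean f d (2 * a + 1) \<in> D"
    using Suc.prems div_power_Suc_eq by (blast intro: Suc.IH)+
  with \<open>convex D\<close> have "(1 / 2) *\<^sub>R block_mean f d (2 * a) + (1 / 2) *\<^sub>R block_mean f d (2 * a + 1) \<in> D"
    by (rule convexD) auto
  then show ?case by (simp add: scaleR_add_right)
qed simp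

text \<open>\<open>S\<close> is the set of safe states (target, response) of a game played from the
  root down. At a node the target splits into \<open>\<phi> + b\<close> and
  \<open>\<phi> - b\<close>, \<open>step\<close> answers with \<open>\<psi> + \<eta>\<close> and
  \<open>\<psi> - \<eta>\<close>, and the plays on the two disjoint child blocks are glued.
  Convexity of \<open>D\<close> keeps all block means of the target inside \<open>D\<close>.\<close>

lemma balanced_lift:
  fixes \<Phi> :: "nat \<Rightarrow> 'a::real_vector" and S :: "('a \<times> 'b::real_vector) set"
  assumes D: "convex D"
    and step: "\<And>\<phi> \<psi> b. (\<phi>, \<psi>) \<in> S \<Longrightarrow> \<phi> + b \<in> D \<Longrightarrow> \<phi> - b \<in> D \<Longrightarrow> \<exists>\<eta>. (\<phi> + b, \<psi> + \<eta>) \<in> S \<and> (\<phi> - b, \<psi> - \<eta>) \<in> S"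
    and \<Phi>: "\<And>l. l div 2 ^ d = a \<Longrightarrow> \<Phi> l \<in> D" "balanced T \<Phi> d a"
    and root: "(block_mean \<Phi> d a, \<psi>) \<in> S"
  shows "\<exists>\<Psi>. (\<forall>l. l div 2 ^ d = a \<longrightarrow> (\<Phi> l, \<Psi> l) \<in> S) \<and> block_mean \<Psi> d a = \<psi> \<and> balanced T \<Psi> d a"
  using \<Phi> root
proof (induction d arbitrary: a \<psi>)
  case 0
  then show ?case by (intro exI[of _ "\<lambda>_. \<psi>"]) auto
next
  case (Suc d)
  define L where "L = block_mean \<Phi> d (2 * a)"
  define R where "R = block_mean \<Phi> d (2 * a + 1)"
  define b where "b = (1 / 2) *\<^sub>R (L - R)"
  have sub: "\<Phi> l \<in> D" if "l div 2 ^ d = 2 * a \<or> l div 2 ^ d = 2 * a + 1" for l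
    using that Suc.prems(1) div_power_Suc_eq by blast
  have mid: "block_mean \<Phi> (Suc d) a = (1 / 2) *\<^sub>R (L + R)"
    by (simp add: L_def R_def)
  have half: "(1 / 2) *\<^sub>R (x + x) = x" for x :: 'a
    by (simp flip: scaleR_2)
  have LR: "(1 / 2) *\<^sub>R (L + R) + b = L" "(1 / 2) *\<^sub>R (L + R) - b = R"
    using half[of L] half[of R] unfolding b_def
    by (simp_all add: scaleR_add_right scaleR_diff_right algebra_simps)
  have "L \<in> D" "R \<in> D"
    unfolding L_def R_def by (auto intro!: block_mean_in_convex D sub)
  obtain \<eta> where \<eta>: "(L, \<psi> + \<eta>) \<in> S" "(R, \<psi> - \<eta>) \<in> S" "(Suc d, a) \<in> T \<Longrightarrow> \<eta> = 0"
  proof (cases "(Suc d, a) \<in> T")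
    case True
    \<comment> \<open>At a node of \<open>T\<close> the target does not move, so the response may
      stay put as well.\<close>
    then have "L = R" using Suc.prems(2) by (simp add: L_def R_def)
    then have "(L, \<psi> + 0) \<in> S" "(R, \<psi> - 0) \<in> S"
      using Suc.prems(3) half[of R] unfolding mid by simp_all
    then show ?thesis using that by blast
  next
    case False
    have "\<exists>\<eta>. ((1 / 2) *\<^sub>R (L + R) + b, \<psi> + \<eta>) \<in> S \<and> ((1 / 2) *\<^sub>R (L + R) - b, \<psi> - \<eta>) \<in> S"
      by (rule step) (use Suc.prems(3) mid LR \<open>L \<in> D\<close> \<open>R \<in> D\<close> in simp_all)
    then show ?thesis using that False unfolding LR by blast
  qed
  obtain \<Psi>L where \<Psi>L: "\<And>l. l div 2 ^ d = 2 * a \<Longrightarrow> (\<Phi> l, \<Psi>L l) \<in> S"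
    "block_mean \<Psi>L d (2 * a) = \<psi> + \<eta>" "balanced T \<Psi>L d (2 * a)"
    using Suc.IH[of "2 * a" "\<psi> + \<eta>"] \<eta> sub Suc.prems(2) by (auto simp: L_def)
  obtain \<Psi>R where \<Psi>R: "\<And>l. l div 2 ^ d = 2 * a + 1 \<Longrightarrow> (\<Phi> l, \<Psi>R l) \<in> S"
    "block_mean \<Psi>R d (2 * a + 1) = \<psi> - \<eta>" "balanced T \<Psi>R d (2 * a + 1)"
    using Suc.IH[of "2 * a + 1" "\<psi> - \<eta>"] \<eta> sub Suc.prems(2) by (auto simp: R_def)
  define \<Psi> where "\<Psi> l = (if l div 2 ^ d = 2 * a then \<Psi>L l else \<Psi>R l)" for l
  have means: "block_mean \<Psi> d (2 * a) = \<psi> + \<eta>" "block_mean \<Psi> d (2 * a + 1) = \<psi> - \<eta>"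
    unfolding \<Psi>L(2)[symmetric] \<Psi>R(2)[symmetric] by (rule block_mean_cong; simp add: \<Psi>_def)+
  have "balanced T \<Psi> d (2 * a)" by (rule balanced_cong[OF _ \<Psi>L(3)]) (simp add: \<Psi>_def)
  moreover have "balanced T \<Psi> d (2 * a + 1)" by (rule balanced_cong[OF _ \<Psi>R(3)]) (simp add: \<Psi>_def)
  moreover have "(\<Phi> l, \<Psi> l) \<in> S" if "l div 2 ^ Suc d = a" for l
  proof -
    have "l div 2 ^ d = 2 * a \<or> l div 2 ^ d = 2 * a + 1"
      using that by (simp only: power_Suc2 div_mult2_eq) linarith
    then show ?thesis using \<Psi>L(1) \<Psi>R(1) by (auto simp: \<Psi>_def)
  qed
  moreover have "block_mean \<Psi> (Suc d) a = \<psi>"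
    using means by (simp flip: scaleR_2)
  ultimately show ?case
    using \<eta>(3) means by (intro exI[of _ \<Psi>]) simp
qed

text \<open>The numbers \<open>a * 2 ^ k + i\<close> enumerate the descendants \<open>k\<close>
  levels below \<open>a\<close>; the condition at a single node is thereby read off from balance at
  the root.\<close>

lemma balanced_descend:
  assumes "balanced T f (k + d) a" "i < 2 ^ k"
  shows "balanced T f d (a * 2 ^ k + i)"
  using assms
proof (induction k arbitrary: a i)
  case (Suc k)
  have IH: "balanced T f d (2 * a * 2 ^ k + j)" "balanced T f d ((2 * a + 1) * 2 ^ k + j)" if "j < 2 ^ k" for j
    using Suc.prems(1) that by (auto intro: Suc.IH simp del: mult_Suc)
  show ?case
  proof (cases "i < 2 ^ k")
    case True
    then show ?thesis using IH(1)[of i] by (simp add: mult_ac)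
  next
    case False
    then have "a * 2 ^ Suc k + i = (2 * a + 1) * 2 ^ k + (i - 2 ^ k)" by (simp add: algebra_simps)
    moreover have "i - 2 ^ k < 2 ^ k" using False Suc.prems(2) by auto
    ultimately show ?thesis by (simp only: IH(2))
  qed
qed simp

lemma balancedI:
  assumes "\<And>d' a'. d' < d \<Longrightarrow> (Suc d', a') \<in> T \<Longrightarrow> block_mean f d' (2 * a') = block_mean f d' (2 * a' + 1)"
  shows "balanced T f d a"
  using assms by (induction d arbitrary: a) auto

lemma block_mean_sum:
  fixes f :: "nat \<Rightarrow> real"
  shows "(\<Sum>l \<in> {l. l div 2 ^ d = a}. f l) = 2 ^ d * block_mean f d a"
proof (induction d arbitrary: a)
  case (Suc d)
  have fin: "finite {l::nat. l div 2 ^ d = c}" for c :: nat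
    by (rule finite_subset[of _ "{..<(c + 1) * 2 ^ d}"]) (auto simp: dividend_less_div_times)
  have "{l. l div 2 ^ Suc d = a} = {l. l div 2 ^ d = 2 * a} \<union> {l. l div 2 ^ d = 2 * a + 1}"
  proof (intro set_eqI iffI)
    fix l assume "l \<in> {l. l div 2 ^ Suc d = a}"
    then have "l div 2 ^ d div 2 = a" by (simp only: power_Suc2 div_mult2_eq mem_Collect_eq)
    then show "l \<in> {l. l div 2 ^ d = 2 * a} \<union> {l. l div 2 ^ d = 2 * a + 1}" by auto
  qed (use div_power_Suc_eq in auto)
  then have "(\<Sum>l \<in> {l. l div 2 ^ Suc d = a}. f l) =
    (\<Sum>l \<in> {l. l div 2 ^ d = 2 * a}. f l) + (\<Sum>l \<in> {l. l div 2 ^ d = 2 * a + 1}. f l)"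
    by (simp only:) (rule sum.union_disjoint, auto simp: fin)
  then show ?case by (simp add: Suc.IH algebra_simps)
qed simp

section \<open>Rademacher sums and the bounded lift\<close>

lemma card_sign_vectors: "card (sign_vectors n) = 2 ^ n"
  unfolding sign_vectors_def by (subst card_PiE) (auto simp: numeral_2_eq_2)

text \<open>Conditioning on the last sign, the engine of the moment inductions below.\<close>

lemma mean_sign_vectors_Suc:
  "mean (sign_vectors (Suc n)) f =
    (mean (sign_vectors n) (\<lambda>\<epsilon>. f (\<epsilon>(Suc n := 1))) + mean (sign_vectors n) (\<lambda>\<epsilon>. f (\<epsilon>(Suc n := -1)))) / 2"
proof -
  have img: "sign_vectors (Suc n) = (\<lambda>(y, g). g(Suc n := y)) ` ({-1, 1} \<times> sign_vectors n)"
  proof -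
    have "{1..Suc n} = insert (Suc n) {1..n}" by auto
    then show ?thesis unfolding sign_vectors_def by (simp only: PiE_insert_eq)
  qed
  have inj: "inj_on (\<lambda>(y, g). g(Suc n := y)) ({-1, 1} \<times> sign_vectors n)"
    unfolding sign_vectors_def by (rule inj_combinator) simp
  have "sum f (sign_vectors (Suc n)) = (\<Sum>(y, g)\<in>{-1, 1} \<times> sign_vectors n. f (g(Suc n := y)))"
    unfolding img sum.reindex[OF inj] by (simp add: case_prod_unfold)
  also have "\<dots> = (\<Sum>g\<in>sign_vectors n. f (g(Suc n := -1))) + (\<Sum>g\<in>sign_vectors n. f (g(Suc n := 1)))"
    unfolding sum.cartesian_product[symmetric] by simp
  finally show ?thesis
    unfolding mean_def card_sign_vectors by (simp add: field_simps)
qed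

definition rademacher_sum :: "nat \<Rightarrow> (nat \<Rightarrow> real) \<Rightarrow> (nat \<Rightarrow> real) \<Rightarrow> real" where
  "rademacher_sum n a \<epsilon> = (\<Sum>j=1..n. a j * \<epsilon> j)"

lemma rademacher_sum_update:
  "rademacher_sum (Suc n) a (\<epsilon>(Suc n := y)) = rademacher_sum n a \<epsilon> + a (Suc n) * y"
  unfolding rademacher_sum_def by (simp cong: sum.cong_simp)

lemma rademacher_sum_add:
  "rademacher_sum n (a + b) \<epsilon> = rademacher_sum n a \<epsilon> + rademacher_sum n b \<epsilon>"
  by (simp add: rademacher_sum_def plus_fun_def algebra_simps sum.distrib)

lemma rademacher_sum_diff:
  "rademacher_sum n (a - b) \<epsilon> = rademacher_sum n a \<epsilon> - rademacher_sum n b \<epsilon>"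
  by (simp add: rademacher_sum_def algebra_simps sum_subtractf)

lemma rademacher_second_moment:
  "mean (sign_vectors n) (\<lambda>\<epsilon>. (rademacher_sum n a \<epsilon>)\<^sup>2) = (\<Sum>j=1..n. (a j)\<^sup>2)"
proof (induction n)
  case 0
  then show ?case by (simp add: rademacher_sum_def mean_def)
next
  case (Suc n)
  define r where "r = rademacher_sum n a"
  have "mean (sign_vectors (Suc n)) (\<lambda>\<epsilon>. (rademacher_sum (Suc n) a \<epsilon>)\<^sup>2) =
    mean (sign_vectors n) (\<lambda>\<epsilon>. (1 / 2) * ((r \<epsilon> + a (Suc n))\<^sup>2 + (r \<epsilon> - a (Suc n))\<^sup>2))"
    unfolding mean_sign_vectors_Suc rademacher_sum_update mean_cmult mean_add by (simp add: r_def)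
  also have "\<dots> = mean (sign_vectors n) (\<lambda>\<epsilon>. (r \<epsilon>)\<^sup>2 + (a (Suc n))\<^sup>2 * 1)"
    by (intro mean_cong) (simp add: power2_eq_square algebra_simps)
  also have "\<dots> = (\<Sum>j=1..Suc n. (a j)\<^sup>2)"
    unfolding mean_add mean_cmult r_def Suc.IH by (simp add: mean_def card_sign_vectors)
  finally show ?case .
qed

text \<open>Khintchine's inequality for exponent 4. Averaging over the last sign removes the odd
  powers, and \<open>3 * s\<^sup>2 + 6 * t\<^sup>2 * s + t ^ 4\<close> is below
  \<open>3 * (s + t\<^sup>2)\<^sup>2\<close>.\<close>

lemma rademacher_fourth_moment:
  "mean (sign_vectors n) (\<lambda>\<epsilon>. rademacher_sum n a \<epsilon> ^ 4) \<le> 3 * (\<Sum>j=1..n. (a j)\<^sup>2)\<^sup>2"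
proof (induction n)
  case 0
  then show ?case by (simp add: rademacher_sum_def mean_def)
next
  case (Suc n)
  define r where "r = rademacher_sum n a"
  define t where "t = a (Suc n)"
  define s where "s = (\<Sum>j=1..n. (a j)\<^sup>2)"
  have "mean (sign_vectors (Suc n)) (\<lambda>\<epsilon>. rademacher_sum (Suc n) a \<epsilon> ^ 4) =
    mean (sign_vectors n) (\<lambda>\<epsilon>. (1 / 2) * ((r \<epsilon> + t) ^ 4 + (r \<epsilon> - t) ^ 4))"
    unfolding mean_sign_vectors_Suc rademacher_sum_update mean_cmult mean_add by (simp add: r_def t_def)
  also have "\<dots> = mean (sign_vectors n) (\<lambda>\<epsilon>. r \<epsilon> ^ 4 + (6 * t\<^sup>2) * (r \<epsilon>)\<^sup>2 + t ^ 4 * 1)"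
    by (intro mean_cong) (simp add: eval_nat_numeral algebra_simps)
  also have "\<dots> \<le> 3 * s\<^sup>2 + 6 * t\<^sup>2 * s + t ^ 4"
    using Suc.IH unfolding mean_add mean_cmult r_def rademacher_second_moment s_def
    by (simp add: mean_def card_sign_vectors)
  also have "\<dots> \<le> 3 * (s + t\<^sup>2)\<^sup>2"
    by (simp add: power2_sum flip: power_mult)
  also have "s + t\<^sup>2 = (\<Sum>j=1..Suc n. (a j)\<^sup>2)" by (simp add: s_def t_def)
  finally show ?case .
qed

text \<open>Polarization of the second moment.\<close>

lemma rademacher_inner:
  "mean (sign_vectors n) (\<lambda>\<epsilon>. rademacher_sum n a \<epsilon> * rademacher_sum n b \<epsilon>) = (\<Sum>j=1..n. a j * b j)"
proof -
  have "mean (sign_vectors n) (\<lambda>\<epsilon>. rademacher_sum n a \<epsilon> * rademacher_sum n b \<epsilon>) =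
    mean (sign_vectors n) (\<lambda>\<epsilon>. (1 / 4) * ((rademacher_sum n (a + b) \<epsilon>)\<^sup>2 - (rademacher_sum n (a - b) \<epsilon>)\<^sup>2))"
    by (intro mean_cong) (simp add: rademacher_sum_add rademacher_sum_diff power2_eq_square algebra_simps)
  also have "\<dots> = (1 / 4) * ((\<Sum>j=1..n. (a j + b j)\<^sup>2) - (\<Sum>j=1..n. (a j - b j)\<^sup>2))"
    unfolding mean_cmult mean_diff rademacher_second_moment by simp
  also have "\<dots> = (\<Sum>j=1..n. a j * b j)"
    unfolding sum_subtractf[symmetric] sum_distrib_left
    by (intro sum.cong) (simp_all add: power2_eq_square algebra_simps)
  finally show ?thesis .
qed

text \<open>Turns closeness in mean square into closeness of Rademacher coefficients: pairing the
  difference with the Rademacher sum of its own coefficients \<open>d\<close> produces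
  \<open>\<Sum> d\<^sup>2\<close>, and \<open>2 * x * y \<le> x\<^sup>2 + y\<^sup>2\<close>
  finishes.\<close>

lemma rademacher_Bessel:
  "(\<Sum>j=1..n. (a j - mean (sign_vectors n) (\<lambda>\<epsilon>. \<epsilon> j * \<psi> \<epsilon>))\<^sup>2)
    \<le> mean (sign_vectors n) (\<lambda>\<epsilon>. (rademacher_sum n a \<epsilon> - \<psi> \<epsilon>)\<^sup>2)"
proof -
  define d where "d j = a j - mean (sign_vectors n) (\<lambda>\<epsilon>. \<epsilon> j * \<psi> \<epsilon>)" for j
  have "mean (sign_vectors n) (\<lambda>\<epsilon>. rademacher_sum n d \<epsilon> * \<psi> \<epsilon>) =
    mean (sign_vectors n) (\<lambda>\<epsilon>. \<Sum>j=1..n. d j * (\<epsilon> j * \<psi> \<epsilon>))"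
    by (simp add: rademacher_sum_def sum_distrib_right mult.assoc)
  also have "\<dots> = (\<Sum>j=1..n. d j * mean (sign_vectors n) (\<lambda>\<epsilon>. \<epsilon> j * \<psi> \<epsilon>))"
    by (simp add: mean_sum mean_cmult)
  finally have \<psi>: "mean (sign_vectors n) (\<lambda>\<epsilon>. rademacher_sum n d \<epsilon> * \<psi> \<epsilon>) = \<dots>" .
  have "mean (sign_vectors n) (\<lambda>\<epsilon>. rademacher_sum n d \<epsilon> * rademacher_sum n a \<epsilon> - rademacher_sum n d \<epsilon> * \<psi> \<epsilon>)
    = (\<Sum>j=1..n. d j * d j)"
    unfolding mean_diff rademacher_inner \<psi> sum_subtractf[symmetric]
    by (intro sum.cong refl) (simp add: d_def algebra_simps)
  moreover have "mean (sign_vectors n) (\<lambda>\<epsilon>. 2 * (rademacher_sum n d \<epsilon> * rademacher_sum n a \<epsilon> - rademacher_sum n d \<epsilon> * \<psi> \<epsilon>))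
    \<le> mean (sign_vectors n) (\<lambda>\<epsilon>. (rademacher_sum n d \<epsilon>)\<^sup>2 + (rademacher_sum n a \<epsilon> - \<psi> \<epsilon>)\<^sup>2)"
  proof (rule mean_mono)
    fix \<epsilon>
    show "2 * (rademacher_sum n d \<epsilon> * rademacher_sum n a \<epsilon> - rademacher_sum n d \<epsilon> * \<psi> \<epsilon>)
      \<le> (rademacher_sum n d \<epsilon>)\<^sup>2 + (rademacher_sum n a \<epsilon> - \<psi> \<epsilon>)\<^sup>2"
      using sum_squares_bound[of "rademacher_sum n d \<epsilon>" "rademacher_sum n a \<epsilon> - \<psi> \<epsilon>"]
      by (simp add: algebra_simps)
  qed
  ultimately show ?thesis
    unfolding mean_cmult mean_add rademacher_second_moment d_def[symmetric] by (simp add: power2_eq_square)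
qed

section \<open>From safe states of the game to a bounded lift\<close>

text \<open>From \<open>s = v * (1 - s\<^sup>2)\<close> one gets
  \<open>X - s = v * s\<^sup>2 - z\<close>, where \<open>v = saturate_inv s\<close> and
  \<open>z = v - X\<close>. If \<open>\<bar>X\<bar> \<le> \<bar>z\<bar>\<close>, the correction
  \<open>v * s\<^sup>2\<close> is charged to \<open>z\<close>; otherwise
  \<open>\<bar>s\<bar> \<le> \<bar>v\<bar> \<le> 2 * \<bar>X\<bar>\<close> makes its square of
  fourth order in \<open>X\<close>.\<close>

lemma saturation_error:
  assumes "\<bar>s\<bar> < 1"
  shows "(X - s)\<^sup>2 \<le> 10 * (saturate_inv s - X)\<^sup>2 + 32 * X ^ 4"
proof -
  define v where "v = saturate_inv s"
  define z where "z = v - X"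
  have s2: "s\<^sup>2 < 1" using assms by (simp add: abs_square_less_1)
  then have sv: "s = v * (1 - s\<^sup>2)" by (simp add: v_def saturate_inv_def)
  have "\<bar>s\<bar> = \<bar>v\<bar> * (1 - s\<^sup>2)" using s2 by (subst sv) (simp add: abs_mult)
  also have "\<dots> \<le> \<bar>v\<bar> * 1" by (intro mult_left_mono) auto
  finally have sle: "\<bar>s\<bar> \<le> \<bar>v\<bar>" by simp
  then have s2v: "s\<^sup>2 \<le> v\<^sup>2" by (simp add: abs_le_square_iff)
  have "(s\<^sup>2)\<^sup>2 \<le> s\<^sup>2 * 1"
    unfolding power2_eq_square[of "s\<^sup>2"] using s2 by (intro mult_left_mono) auto
  then have s4: "(s\<^sup>2)\<^sup>2 \<le> s\<^sup>2" "(s\<^sup>2)\<^sup>2 \<le> 1"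
    using s2 by linarith+
  have w: "(v * s\<^sup>2)\<^sup>2 \<le> 4 * z\<^sup>2 + 16 * X ^ 4"
  proof (cases "\<bar>X\<bar> \<le> \<bar>z\<bar>")
    case True
    then have "\<bar>v\<bar> \<le> 2 * \<bar>z\<bar>"
      using abs_triangle_ineq[of z X] by (simp add: z_def)
    then have "v\<^sup>2 \<le> (2 * z)\<^sup>2"
      using abs_le_square_iff[of v "2 * z"] by (simp add: abs_mult)
    then have "v\<^sup>2 \<le> 4 * z\<^sup>2" by (simp add: power_mult_distrib)
    moreover have "v\<^sup>2 * (s\<^sup>2)\<^sup>2 \<le> v\<^sup>2 * 1" by (intro mult_left_mono s4) auto
    moreover have "0 \<le> X ^ 4" by simp
    ultimately show ?thesis unfolding power_mult_distrib by linarith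
  next
    case False
    then have "\<bar>v\<bar> \<le> 2 * \<bar>X\<bar>"
      using abs_triangle_ineq[of z X] by (simp add: z_def)
    then have "v\<^sup>2 \<le> (2 * X)\<^sup>2"
      using abs_le_square_iff[of v "2 * X"] by (simp add: abs_mult)
    then have "(v\<^sup>2)\<^sup>2 \<le> ((2 * X)\<^sup>2)\<^sup>2" by (rule power_mono) simp
    moreover have "v\<^sup>2 * (s\<^sup>2)\<^sup>2 \<le> v\<^sup>2 * v\<^sup>2" using s4 s2v by (intro mult_left_mono) auto
    moreover have "((2 * X)\<^sup>2)\<^sup>2 = 16 * X ^ 4" by (simp add: power_mult_distrib flip: power_mult)
    moreover have "0 \<le> z\<^sup>2" by simp
    ultimately show ?thesis
      unfolding power_mult_distrib[of v "s\<^sup>2"] power2_eq_square[of "v\<^sup>2"] by linarith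
  qed
  have "X - s = v * s\<^sup>2 - z" using sv unfolding z_def by (simp add: algebra_simps)
  then have "(X - s)\<^sup>2 \<le> 2 * (v * s\<^sup>2)\<^sup>2 + 2 * z\<^sup>2"
    using sum_squares_bound[of "v * s\<^sup>2" "- z"] by (simp add: power2_diff)
  then show ?thesis using w unfolding z_def v_def by linarith
qed

text \<open>
  The scale \<open>1 / 10 ^ 11\<close> keeps the Rademacher sums mostly in the range where saturation is
  invisible; its inverse is, up to a factor 2, the cotype constant obtained.
\<close>

definition game_states :: "nat \<Rightarrow> ((nat \<Rightarrow> real) \<times> ((nat \<Rightarrow> real) \<Rightarrow> real)) set" where
  "game_states n = {(\<phi>, s). (\<forall>\<epsilon>\<in>sign_vectors n. \<bar>s \<epsilon>\<bar> < 1) \<and>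
    mean (sign_vectors n) (\<lambda>\<epsilon>. (saturate_inv (s \<epsilon>) - 1 / 10 ^ 11 * rademacher_sum n \<phi> \<epsilon>)\<^sup>2)
      \<le> 1 / 100 * (1 / 10 ^ 11)\<^sup>2 + 1 / 10 ^ 6 * mean (sign_vectors n) (\<lambda>\<epsilon>. (1 / 10 ^ 11 * rademacher_sum n \<phi> \<epsilon>)\<^sup>2)}"

definition l2_ball :: "nat \<Rightarrow> (nat \<Rightarrow> real) set" where
  "l2_ball n = {\<phi>. (\<Sum>j=1..n. (\<phi> j)\<^sup>2) \<le> 1}"

lemma convex_l2_ball: "convex (l2_ball n)"
proof (rule convexI)
  fix x y :: "nat \<Rightarrow> real" and u v :: real
  assume *: "x \<in> l2_ball n" "y \<in> l2_ball n" "0 \<le> u" "0 \<le> v" "u + v = 1"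
  have "(\<Sum>j=1..n. (u * x j + v * y j)\<^sup>2) \<le> (\<Sum>j=1..n. u * (x j)\<^sup>2 + v * (y j)\<^sup>2)"
  proof (rule sum_mono)
    fix j
    show "(u * x j + v * y j)\<^sup>2 \<le> u * (x j)\<^sup>2 + v * (y j)\<^sup>2"
    proof -
      have u: "u = 1 - v" using * by simp
      have "u * (x j)\<^sup>2 + v * (y j)\<^sup>2 - (u * x j + v * y j)\<^sup>2 = u * v * (x j - y j)\<^sup>2"
        unfolding u by (simp add: power2_eq_square algebra_simps)
      moreover have "0 \<le> u * v * (x j - y j)\<^sup>2" using * by simp
      ultimately show ?thesis by linarith
    qed
  qed
  also have "\<dots> = u * (\<Sum>j=1..n. (x j)\<^sup>2) + v * (\<Sum>j=1..n. (y j)\<^sup>2)"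
    by (simp add: sum.distrib sum_distrib_left)
  also have "\<dots> \<le> u * 1 + v * 1"
    using * by (intro add_mono mult_left_mono) (auto simp: l2_ball_def)
  finally show "u *\<^sub>R x + v *\<^sub>R y \<in> l2_ball n"
    using * by (simp add: l2_ball_def plus_fun_def scaleR_fun_def)
qed

text \<open>An instance of \<open>game_step\<close> for the scaled Rademacher sums of
  \<open>\<phi>\<close> and \<open>b\<close>. By the parallelogram law the squared norms of
  \<open>\<phi>\<close> and \<open>b\<close> add up to the average of those of
  \<open>\<phi> + b\<close> and \<open>\<phi> - b\<close>, hence to at most 1; this is the bound on
  \<open>V + W\<close>.\<close>

lemma game_states_step:
  assumes st: "(\<phi>, s) \<in> game_states n" and b: "\<phi> + b \<in> l2_ball n" "\<phi> - b \<in> l2_ball n"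
  shows "\<exists>\<eta>. (\<phi> + b, s + \<eta>) \<in> game_states n \<and> (\<phi> - b, s - \<eta>) \<in> game_states n"
proof -
  define \<theta> :: real where "\<theta> = 1 / 10 ^ 11"
  define \<Omega> where "\<Omega> = sign_vectors n"
  define X where "X \<epsilon> = \<theta> * rademacher_sum n \<phi> \<epsilon>" for \<epsilon>
  define \<beta> where "\<beta> \<epsilon> = \<theta> * rademacher_sum n b \<epsilon>" for \<epsilon>
  have m2: "mean \<Omega> (\<lambda>\<epsilon>. (\<theta> * rademacher_sum n a \<epsilon>)\<^sup>2) = \<theta>\<^sup>2 * (\<Sum>j=1..n. (a j)\<^sup>2)" for a
    unfolding power_mult_distrib mean_cmult \<Omega>_def rademacher_second_moment ..
  have m4: "mean \<Omega> (\<lambda>\<epsilon>. (\<theta> * rademacher_sum n a \<epsilon>) ^ 4)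
    \<le> 3 * (mean \<Omega> (\<lambda>\<epsilon>. (\<theta> * rademacher_sum n a \<epsilon>)\<^sup>2))\<^sup>2" for a
  proof -
    have "mean \<Omega> (\<lambda>\<epsilon>. (\<theta> * rademacher_sum n a \<epsilon>) ^ 4) \<le> \<theta> ^ 4 * (3 * (\<Sum>j=1..n. (a j)\<^sup>2)\<^sup>2)"
      unfolding power_mult_distrib mean_cmult \<Omega>_def
      by (intro mult_left_mono rademacher_fourth_moment) (simp add: \<theta>_def)
    also have "\<dots> = 3 * (\<theta>\<^sup>2 * (\<Sum>j=1..n. (a j)\<^sup>2))\<^sup>2"
      by (simp add: power_mult_distrib flip: power_mult)
    finally show ?thesis unfolding m2 .
  qed
  have "(\<Sum>j=1..n. (\<phi> j)\<^sup>2) + (\<Sum>j=1..n. (b j)\<^sup>2) =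
    (1 / 2) * ((\<Sum>j=1..n. ((\<phi> + b) j)\<^sup>2) + (\<Sum>j=1..n. ((\<phi> - b) j)\<^sup>2))"
    unfolding sum.distrib[symmetric] sum_distrib_left
    by (intro sum.cong) (simp_all add: power2_eq_square algebra_simps)
  also have "\<dots> \<le> 1" using b by (simp add: l2_ball_def)
  finally have "\<theta>\<^sup>2 * ((\<Sum>j=1..n. (\<phi> j)\<^sup>2) + (\<Sum>j=1..n. (b j)\<^sup>2)) \<le> \<theta>\<^sup>2 * 1"
    by (rule mult_left_mono) simp
  then have VW: "mean \<Omega> (\<lambda>\<epsilon>. (X \<epsilon>)\<^sup>2) + mean \<Omega> (\<lambda>\<epsilon>. (\<beta> \<epsilon>)\<^sup>2) \<le> \<theta>\<^sup>2"
    unfolding X_def \<beta>_def m2 by (simp add: distrib_left)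
  have s: "\<bar>s \<epsilon>\<bar> < 1" if "\<epsilon> \<in> \<Omega>" for \<epsilon> using st that by (simp add: game_states_def \<Omega>_def)
  have inv: "mean \<Omega> (\<lambda>\<epsilon>. (saturate_inv (s \<epsilon>) - X \<epsilon>)\<^sup>2) \<le> 1 / 100 * \<theta>\<^sup>2 + 1 / 10 ^ 6 * mean \<Omega> (\<lambda>\<epsilon>. (X \<epsilon>)\<^sup>2)"
    using st unfolding game_states_def \<Omega>_def X_def \<theta>_def by blast
  obtain \<eta> where \<eta>: "\<And>\<sigma>. \<sigma> \<in> {1, -1} \<Longrightarrow> (\<forall>\<epsilon>\<in>\<Omega>. \<bar>s \<epsilon> + \<sigma> * \<eta> \<epsilon>\<bar> < 1) \<and>
    mean \<Omega> (\<lambda>\<epsilon>. (saturate_inv (s \<epsilon> + \<sigma> * \<eta> \<epsilon>) - (X \<epsilon> + \<sigma> * \<beta> \<epsilon>))\<^sup>2)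
      \<le> 1 / 100 * \<theta>\<^sup>2 + 1 / 10 ^ 6 * mean \<Omega> (\<lambda>\<epsilon>. (X \<epsilon> + \<sigma> * \<beta> \<epsilon>)\<^sup>2)"
    using game_step[OF s VW[unfolded \<theta>_def] m4[of \<phi>, folded X_def] m4[of b, folded \<beta>_def] inv[unfolded \<theta>_def]]
    unfolding \<theta>_def[symmetric] by blast
  have "(\<phi> + b, s + \<eta>) \<in> game_states n"
    unfolding game_states_def \<theta>_def[symmetric] \<Omega>_def[symmetric]
    using \<eta>[of 1] by (simp add: X_def \<beta>_def rademacher_sum_add distrib_left)
  moreover have "(\<phi> - b, s - \<eta>) \<in> game_states n"
    unfolding game_states_def \<theta>_def[symmetric] \<Omega>_def[symmetric]
    using \<eta>[of "-1"] by (simp add: X_def \<beta>_def rademacher_sum_diff right_diff_distrib)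
  ultimately show ?thesis by blast
qed

text \<open>Surjectivity of \<open>saturate_inv\<close> allows a start with discrepancy
  zero.\<close>

lemma game_states_start: "\<exists>s. (\<phi>, s) \<in> game_states n"
proof -
  have "\<forall>\<epsilon>. \<exists>s. \<bar>s\<bar> < 1 \<and> saturate_inv s = 1 / 10 ^ 11 * rademacher_sum n \<phi> \<epsilon>"
    using saturate_inv_surj by metis
  then obtain s where s: "\<And>\<epsilon>. \<bar>s \<epsilon>\<bar> < 1" "\<And>\<epsilon>. saturate_inv (s \<epsilon>) = 1 / 10 ^ 11 * rademacher_sum n \<phi> \<epsilon>"
    by metis
  have "0 \<le> mean (sign_vectors n) (\<lambda>\<epsilon>. (1 / 10 ^ 11 * rademacher_sum n \<phi> \<epsilon>)\<^sup>2)"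
    by (intro mean_nonneg) simp
  then have "(\<phi>, s) \<in> game_states n"
    unfolding game_states_def by (simp add: s mean_def)
  then show ?thesis by blast
qed

lemma game_states_close:
  assumes "(\<phi>, s) \<in> game_states n" "\<phi> \<in> l2_ball n"
  shows "mean (sign_vectors n) (\<lambda>\<epsilon>. (rademacher_sum n \<phi> \<epsilon> - 10 ^ 11 * s \<epsilon>)\<^sup>2) \<le> 1 / 4"
proof -
  define \<theta> :: real where "\<theta> = 1 / 10 ^ 11"
  define \<Omega> where "\<Omega> = sign_vectors n"
  define X where "X \<epsilon> = \<theta> * rademacher_sum n \<phi> \<epsilon>" for \<epsilon>
  define t where "t = (\<Sum>j=1..n. (\<phi> j)\<^sup>2)"
  have t: "0 \<le> t" "t \<le> 1" using assms(2) by (auto simp: t_def l2_ball_def sum_nonneg)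
  have X2: "mean \<Omega> (\<lambda>\<epsilon>. (X \<epsilon>)\<^sup>2) = \<theta>\<^sup>2 * t"
    unfolding X_def power_mult_distrib mean_cmult \<Omega>_def rademacher_second_moment t_def ..
  have X4: "mean \<Omega> (\<lambda>\<epsilon>. X \<epsilon> ^ 4) \<le> \<theta> ^ 4 * (3 * t\<^sup>2)"
    unfolding X_def power_mult_distrib mean_cmult \<Omega>_def t_def
    by (intro mult_left_mono rademacher_fourth_moment) (simp add: \<theta>_def)
  also have "\<dots> \<le> \<theta> ^ 4 * 3"
    using t by (intro mult_left_mono) (auto simp: power_le_one)
  also have "\<dots> \<le> \<theta>\<^sup>2 / 1000" by (simp add: \<theta>_def field_simps)
  finally have X4: "mean \<Omega> (\<lambda>\<epsilon>. X \<epsilon> ^ 4) \<le> \<theta>\<^sup>2 / 1000" .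
  have "mean \<Omega> (\<lambda>\<epsilon>. (saturate_inv (s \<epsilon>) - X \<epsilon>)\<^sup>2) \<le> 1 / 100 * \<theta>\<^sup>2 + 1 / 10 ^ 6 * (\<theta>\<^sup>2 * t)"
    using assms(1) unfolding game_states_def \<Omega>_def[symmetric] X2[symmetric] by (simp add: X_def \<theta>_def)
  moreover have "\<theta>\<^sup>2 * t \<le> \<theta>\<^sup>2" using t by (simp add: mult_left_le)
  ultimately have "mean \<Omega> (\<lambda>\<epsilon>. (saturate_inv (s \<epsilon>) - X \<epsilon>)\<^sup>2) \<le> \<theta>\<^sup>2 / 100 + \<theta>\<^sup>2 / 1000000"
    by simp
  then have z: "mean \<Omega> (\<lambda>\<epsilon>. (saturate_inv (s \<epsilon>) - X \<epsilon>)\<^sup>2) \<le> \<theta>\<^sup>2 / 50"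
    using zero_le_power2[of \<theta>] by linarith
  have "mean \<Omega> (\<lambda>\<epsilon>. (X \<epsilon> - s \<epsilon>)\<^sup>2) \<le> mean \<Omega> (\<lambda>\<epsilon>. 10 * (saturate_inv (s \<epsilon>) - X \<epsilon>)\<^sup>2 + 32 * X \<epsilon> ^ 4)"
    using assms(1) by (intro mean_mono saturation_error) (simp add: game_states_def \<Omega>_def)
  \<comment> \<open>10/50 + 32/1000 is below 1/4.\<close>
  then have "mean \<Omega> (\<lambda>\<epsilon>. (X \<epsilon> - s \<epsilon>)\<^sup>2) \<le> \<theta>\<^sup>2 / 4"
    using z X4 zero_le_power2[of \<theta>] unfolding mean_add mean_cmult by linarith
  moreover have "(rademacher_sum n \<phi> \<epsilon> - 10 ^ 11 * s \<epsilon>)\<^sup>2 = (10 ^ 11)\<^sup>2 * (X \<epsilon> - s \<epsilon>)\<^sup>2" for \<epsilon>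
    unfolding power_mult_distrib[symmetric] X_def \<theta>_def by (simp add: algebra_simps)
  ultimately show ?thesis
    by (simp add: \<Omega>_def[symmetric] mean_cmult \<theta>_def power_divide)
qed

lemma bounded_rademacher_lift:
  assumes \<Phi>: "\<And>l. l < 2 ^ M \<Longrightarrow> \<Phi> l \<in> l2_ball n" "balanced T \<Phi> M 0"
  obtains s where "balanced T s M 0"
    "\<And>l \<epsilon>. l < 2 ^ M \<Longrightarrow> \<epsilon> \<in> sign_vectors n \<Longrightarrow> \<bar>s l \<epsilon>\<bar> < 1"
    "\<And>l. l < 2 ^ M \<Longrightarrow> (\<Sum>j=1..n. (\<Phi> l j - 10 ^ 11 * mean (sign_vectors n) (\<lambda>\<epsilon>. \<epsilon> j * s l \<epsilon>))\<^sup>2) \<le> 1 / 4"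
proof -
  have div: "l div 2 ^ M = 0 \<longleftrightarrow> l < 2 ^ M" for l :: nat by (simp add: div_eq_0_iff)
  obtain s0 where s0: "(block_mean \<Phi> M 0, s0) \<in> game_states n" using game_states_start by blast
  obtain s where s: "\<And>l. l < 2 ^ M \<Longrightarrow> (\<Phi> l, s l) \<in> game_states n" "balanced T s M 0"
    using balanced_lift[OF convex_l2_ball game_states_step _ \<Phi>(2) s0] \<Phi>(1) unfolding div by blast
  show ?thesis
  proof (rule that[OF s(2)])
    fix l :: nat assume l: "l < 2 ^ M"
    show "\<bar>s l \<epsilon>\<bar> < 1" if "\<epsilon> \<in> sign_vectors n" for \<epsilon>
      using s(1)[OF l] that by (simp add: game_states_def)
    have "mean (sign_vectors n) (\<lambda>\<epsilon>. \<epsilon> j * (10 ^ 11 * s l \<epsilon>)) = 10 ^ 11 * mean (sign_vectors n) (\<lambda>\<epsilon>. \<epsilon> j * s l \<epsilon>)" for j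
      unfolding mult.left_commute[of _ "10 ^ 11"] mean_cmult ..
    then show "(\<Sum>j=1..n. (\<Phi> l j - 10 ^ 11 * mean (sign_vectors n) (\<lambda>\<epsilon>. \<epsilon> j * s l \<epsilon>))\<^sup>2) \<le> 1 / 4"
      using rademacher_Bessel[of "\<Phi> l" n "\<lambda>\<epsilon>. 10 ^ 11 * s l \<epsilon>"] game_states_close[OF s(1)[OF l] \<Phi>(1)[OF l]]
      by simp
  qed
qed

section \<open>Norming functionals\<close>

text \<open>Hahn-Banach along finitely many vectors, with the functional recorded by its values
  \<open>a i\<close> on \<open>v i\<close>. The \<open>v i\<close> may be dependent: demanding the
  inequality for all coefficients \<open>t\<close> makes the values consistent.\<close>

lemma finite_Hahn_Banach:
  fixes p :: "'a::real_vector \<Rightarrow> real" and v :: "nat \<Rightarrow> 'a"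
  assumes add: "\<And>x y. p (x + y) \<le> p x + p y" and scale: "\<And>t x. 0 \<le> t \<Longrightarrow> p (t *\<^sub>R x) = t * p x"
  shows "\<exists>a. a 0 = p (v 0) \<and> (\<forall>t. (\<Sum>i\<le>k. t i * a i) \<le> p (\<Sum>i\<le>k. t i *\<^sub>R v i))"
proof (induction k)
  case 0
  have p0: "p 0 = 0" using scale[of 0 0] by simp
  have "t * p (v 0) \<le> p (t *\<^sub>R v 0)" for t
  proof (cases "0 \<le> t")
    case False
    have "0 \<le> p (t *\<^sub>R v 0) + p ((- t) *\<^sub>R v 0)" using add[of "t *\<^sub>R v 0" "(- t) *\<^sub>R v 0"] p0 by simp
    then show ?thesis using scale[of "- t" "v 0"] False by simp
  qed (simp add: scale)
  then show ?case by (intro exI[of _ "\<lambda>_. p (v 0)"]) simp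
next
  case (Suc k)
  then obtain a where a: "a 0 = p (v 0)" "\<And>t. (\<Sum>i\<le>k. t i * a i) \<le> p (\<Sum>i\<le>k. t i *\<^sub>R v i)"
    by blast
  define w where "w = v (Suc k)"
  define F where "F t = (\<Sum>i\<le>k. t i * a i)" for t
  define G where "G t = (\<Sum>i\<le>k. t i *\<^sub>R v i)" for t
  have FG: "F t \<le> p (G t)" for t using a(2) by (simp add: F_def G_def)
  have Fs: "F (\<lambda>i. c * t i) = c * F t" "G (\<lambda>i. c * t i) = c *\<^sub>R G t" for c t
    by (simp_all add: F_def G_def sum_distrib_left scaleR_sum_right mult.assoc)
  have cross: "F t - p (G t - w) \<le> p (G t' + w) - F t'" for t t'
  proof -
    have "F t + F t' = F (\<lambda>i. t i + t' i)" "G t + G t' = G (\<lambda>i. t i + t' i)"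
      by (simp_all add: F_def G_def sum.distrib algebra_simps)
    then show ?thesis using FG[of "\<lambda>i. t i + t' i"] add[of "G t - w" "G t' + w"] by (simp add: algebra_simps)
  qed
  \<comment> \<open>The value on the new vector \<open>w\<close>: the least one meeting all lower
    constraints. By \<open>cross\<close> no lower constraint exceeds an upper one.\<close>
  define \<alpha> where "\<alpha> = (SUP t. F t - p (G t - w))"
  have bdd: "bdd_above (range (\<lambda>t. F t - p (G t - w)))"
    using cross[of _ "\<lambda>_. 0"] by (auto intro!: bdd_aboveI)
  have lower: "F t - p (G t - w) \<le> \<alpha>" for t
    unfolding \<alpha>_def by (rule cSUP_upper[OF _ bdd]) simp
  have upper: "\<alpha> \<le> p (G t + w) - F t" for t
    unfolding \<alpha>_def by (rule cSUP_least) (auto intro: cross)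
  \<comment> \<open>Positive homogeneity reduces the coefficient \<open>\<tau>\<close> of
    \<open>w\<close> to 1 or -1, where \<open>upper\<close> and \<open>lower\<close> apply.\<close>
  have ext: "F t + \<tau> * \<alpha> \<le> p (G t + \<tau> *\<^sub>R w)" for t \<tau>
  proof -
    consider "\<tau> = 0" | "\<tau> > 0" | "\<tau> < 0" by linarith
    then show ?thesis
    proof cases
      case 1
      then show ?thesis using FG by simp
    next
      case 2
      have "\<tau> * \<alpha> \<le> \<tau> * (p (G (\<lambda>i. inverse \<tau> * t i) + w) - F (\<lambda>i. inverse \<tau> * t i))"
        using 2 upper by (intro mult_left_mono) auto
      also have "\<dots> = p (\<tau> *\<^sub>R (inverse \<tau> *\<^sub>R G t + w)) - F t"
        using 2 by (simp add: Fs scale right_diff_distrib)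
      finally show ?thesis using 2 by (simp add: scaleR_add_right)
    next
      case 3
      define \<sigma> where "\<sigma> = - \<tau>"
      have \<sigma>: "\<sigma> > 0" using 3 by (simp add: \<sigma>_def)
      have "\<sigma> * (F (\<lambda>i. inverse \<sigma> * t i) - p (G (\<lambda>i. inverse \<sigma> * t i) - w)) \<le> \<sigma> * \<alpha>"
        using \<sigma> lower by (intro mult_left_mono) auto
      also have "\<sigma> * (F (\<lambda>i. inverse \<sigma> * t i) - p (G (\<lambda>i. inverse \<sigma> * t i) - w)) =
          F t - p (\<sigma> *\<^sub>R (inverse \<sigma> *\<^sub>R G t - w))"
        using \<sigma> by (simp add: Fs scale right_diff_distrib)
      finally show ?thesis using \<sigma> by (simp add: scaleR_diff_right) (simp add: \<sigma>_def)
    qed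
  qed
  have "(\<Sum>i\<le>Suc k. t i * (a(Suc k := \<alpha>)) i) \<le> p (\<Sum>i\<le>Suc k. t i *\<^sub>R v i)" for t
    using ext[of t "t (Suc k)"] by (simp add: F_def G_def w_def)
  then show ?case using a(1) by (intro exI[of _ "a(Suc k := \<alpha>)"]) simp
qed

section \<open>Discretized norm, quotient norm and pairing\<close>

lemma sum_fun_apply: "(\<Sum>i\<in>I. f i) t = (\<Sum>i\<in>I. f i t)"
  by (induction I rule: infinite_finite_induct) auto

text \<open>The integral norm of a step function on \<open>2 ^ M\<close> equal leaves, sampled at
  left endpoints. On arbitrary functions it is only a seminorm.\<close>

definition leaf_norm :: "nat \<Rightarrow> (real \<Rightarrow> real) \<Rightarrow> real" where
  "leaf_norm M f = (\<Sum>l<2 ^ M. \<bar>f (real l / 2 ^ M)\<bar>) / 2 ^ M"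

lemma leaf_norm_nonneg: "0 \<le> leaf_norm M f"
  by (simp add: leaf_norm_def sum_nonneg)

lemma leaf_norm_triangle: "leaf_norm M (f + g) \<le> leaf_norm M f + leaf_norm M g"
  unfolding leaf_norm_def add_divide_distrib[symmetric] sum.distrib[symmetric]
  by (intro divide_right_mono sum_mono) (auto intro: abs_triangle_ineq)

lemma leaf_norm_scaleR: "leaf_norm M (c *\<^sub>R f) = \<bar>c\<bar> * leaf_norm M f"
  by (simp add: leaf_norm_def scaleR_fun_def abs_mult sum_distrib_left)

definition leaf_quotient :: "nat \<Rightarrow> (real \<Rightarrow> real) set \<Rightarrow> (real \<Rightarrow> real) \<Rightarrow> real" where
  "leaf_quotient M Y x = (INF y\<in>Y. leaf_norm M (x + y))"

lemma bdd_below_leaf_norm: "bdd_below ((\<lambda>y. leaf_norm M (x + y)) ` Y)"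
  by (rule bdd_belowI[of _ 0]) (auto simp: leaf_norm_nonneg)

lemma leaf_quotient_le: "y \<in> Y \<Longrightarrow> leaf_quotient M Y x \<le> leaf_norm M (x + y)"
  unfolding leaf_quotient_def by (rule cINF_lower[OF bdd_below_leaf_norm])

lemma leaf_quotient_nonneg: "subspace Y \<Longrightarrow> 0 \<le> leaf_quotient M Y x"
  unfolding leaf_quotient_def by (rule cINF_greatest) (auto simp: leaf_norm_nonneg dest: subspace_0)

lemma leaf_quotient_triangle:
  assumes "subspace Y"
  shows "leaf_quotient M Y (x + x') \<le> leaf_quotient M Y x + leaf_quotient M Y x'"
proof -
  have ne: "Y \<noteq> {}" using subspace_0[OF assms] by auto
  have "leaf_quotient M Y (x + x') - leaf_norm M (x + y) \<le> leaf_norm M (x' + y')" if "y \<in> Y" "y' \<in> Y" for y y'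
  proof -
    have "leaf_quotient M Y (x + x') \<le> leaf_norm M ((x + x') + (y + y'))"
      by (rule leaf_quotient_le) (rule subspace_add[OF assms that])
    also have "(x + x') + (y + y') = (x + y) + (x' + y')" by (simp add: algebra_simps)
    finally show ?thesis using leaf_norm_triangle[of M "x + y" "x' + y'"] by linarith
  qed
  then have *: "leaf_quotient M Y (x + x') - leaf_norm M (x + y) \<le> leaf_quotient M Y x'" if "y \<in> Y" for y
    unfolding leaf_quotient_def[of M Y x'] using that ne by (intro cINF_greatest) auto
  have "leaf_quotient M Y (x + x') - leaf_quotient M Y x' \<le> leaf_norm M (x + y)" if "y \<in> Y" for y
    using *[OF that] by linarith
  then have "leaf_quotient M Y (x + x') - leaf_quotient M Y x' \<le> leaf_quotient M Y x"
    unfolding leaf_quotient_def[of M Y x] using ne by (intro cINF_greatest) auto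
  then show ?thesis by simp
qed

lemma leaf_quotient_scaleR_le:
  assumes Y: "subspace Y" and c: "0 < c"
  shows "leaf_quotient M Y (c *\<^sub>R x) \<le> c * leaf_quotient M Y x"
proof -
  have "leaf_quotient M Y (c *\<^sub>R x) / c \<le> leaf_norm M (x + y)" if "y \<in> Y" for y
  proof -
    have "leaf_quotient M Y (c *\<^sub>R x) \<le> leaf_norm M (c *\<^sub>R x + c *\<^sub>R y)"
      by (rule leaf_quotient_le) (rule subspace_scale[OF Y that])
    also have "\<dots> = c * leaf_norm M (x + y)"
      using c by (simp only: scaleR_add_right[symmetric] leaf_norm_scaleR)
    finally show ?thesis using c by (simp add: divide_le_eq mult.commute)
  qed
  then have "leaf_quotient M Y (c *\<^sub>R x) / c \<le> leaf_quotient M Y x"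
    unfolding leaf_quotient_def[of M Y x] using subspace_0[OF Y] by (intro cINF_greatest) auto
  then show ?thesis using c by (simp add: divide_le_eq mult.commute)
qed

lemma leaf_quotient_scaleR:
  assumes Y: "subspace Y" and c: "0 \<le> c"
  shows "leaf_quotient M Y (c *\<^sub>R x) = c * leaf_quotient M Y x"
proof (cases "c = 0")
  case True
  have "leaf_quotient M Y 0 \<le> leaf_norm M (0 + 0)" by (rule leaf_quotient_le) (rule subspace_0[OF Y])
  then have "leaf_quotient M Y 0 \<le> 0" by (simp add: leaf_norm_def)
  then show ?thesis using leaf_quotient_nonneg[OF Y, of M 0] True by simp
next
  case False
  then have c: "c > 0" using c by simp
  have "leaf_quotient M Y (inverse c *\<^sub>R (c *\<^sub>R x)) \<le> inverse c * leaf_quotient M Y (c *\<^sub>R x)"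
    using c by (intro leaf_quotient_scaleR_le Y) simp
  then have "c * leaf_quotient M Y x \<le> leaf_quotient M Y (c *\<^sub>R x)"
    using c by (simp add: field_simps)
  then show ?thesis using leaf_quotient_scaleR_le[OF Y c, of M x] by simp
qed

definition leaf_pairing :: "nat \<Rightarrow> (nat \<Rightarrow> real) \<Rightarrow> (real \<Rightarrow> real) \<Rightarrow> real" where
  "leaf_pairing M \<phi> f = (\<Sum>l<2 ^ M. \<phi> l * f (real l / 2 ^ M)) / 2 ^ M"

lemma leaf_pairing_add: "leaf_pairing M \<phi> (f + g) = leaf_pairing M \<phi> f + leaf_pairing M \<phi> g"
  by (simp add: leaf_pairing_def algebra_simps sum.distrib add_divide_distrib)

lemma leaf_pairing_le_quotient:
  assumes Y: "subspace Y" and \<phi>: "\<And>l. l < 2 ^ M \<Longrightarrow> \<bar>\<phi> l\<bar> \<le> 1" "\<And>y. y \<in> Y \<Longrightarrow> leaf_pairing M \<phi> y = 0"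
  shows "leaf_pairing M \<phi> x \<le> leaf_quotient M Y x"
  unfolding leaf_quotient_def
proof (rule cINF_greatest)
  show "Y \<noteq> {}" using subspace_0[OF Y] by auto
  fix y assume "y \<in> Y"
  then have "leaf_pairing M \<phi> x = leaf_pairing M \<phi> (x + y)" by (simp add: leaf_pairing_add \<phi>(2))
  also have "\<dots> \<le> leaf_norm M (x + y)"
    unfolding leaf_pairing_def leaf_norm_def
  proof (intro divide_right_mono sum_mono)
    fix l :: nat assume "l \<in> {..<2 ^ M}"
    then have "\<bar>\<phi> l\<bar> * \<bar>(x + y) (real l / 2 ^ M)\<bar> \<le> 1 * \<bar>(x + y) (real l / 2 ^ M)\<bar>"
      using \<phi>(1) by (intro mult_right_mono) auto
    then show "\<phi> l * (x + y) (real l / 2 ^ M) \<le> \<bar>(x + y) (real l / 2 ^ M)\<bar>"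
      by (simp add: abs_mult[symmetric])
  qed simp
  finally show "leaf_pairing M \<phi> x \<le> leaf_norm M (x + y)" .
qed

lemma leaf_quotient_cong:
  assumes "\<And>l. l < 2 ^ M \<Longrightarrow> x (real l / 2 ^ M) = x' (real l / 2 ^ M)"
  shows "leaf_quotient M Y x = leaf_quotient M Y x'"
  unfolding leaf_quotient_def leaf_norm_def using assms by simp

text \<open>Hahn-Banach for the quotient seminorm, started at \<open>x\<close> and extended over the
  leaf indicators. Only samples matter to the seminorm, so the values on the leaf indicators form a
  density representing the functional.\<close>

lemma norming_leaf_functional:
  assumes Y: "subspace Y"
  obtains \<phi> where "\<And>l. l < 2 ^ M \<Longrightarrow> \<bar>\<phi> l\<bar> \<le> 1" "\<And>y. y \<in> Y \<Longrightarrow> leaf_pairing M \<phi> y = 0"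
    "leaf_pairing M \<phi> x = leaf_quotient M Y x"
proof -
  define K :: nat where "K = 2 ^ M"
  \<comment> \<open>The indicator of a single point stands for that of a whole leaf, as only left
    endpoints are sampled.\<close>
  define e :: "nat \<Rightarrow> real \<Rightarrow> real" where "e l = indicator {real l / 2 ^ M}" for l
  define v where "v i = (case i of 0 \<Rightarrow> x | Suc l \<Rightarrow> e l)" for i
  obtain a where a0: "a 0 = leaf_quotient M Y x"
    and a: "\<And>t. (\<Sum>i\<le>K. t i * a i) \<le> leaf_quotient M Y (\<Sum>i\<le>K. t i *\<^sub>R v i)"
    using finite_Hahn_Banach[of "leaf_quotient M Y" v K, OF leaf_quotient_triangle[OF Y] leaf_quotient_scaleR[OF Y]]
    by (auto simp: v_def)
  have K0: "{..K} = insert 0 (Suc ` {..<K})"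
    by (simp only: lessThan_Suc_atMost[symmetric] lessThan_Suc_eq_insert_0)
  have e: "e l (real l' / 2 ^ M) = of_bool (l = l')" for l l'
    by (auto simp: e_def indicator_def)
  have b: "c * leaf_quotient M Y x + (\<Sum>l<K. t l * a (Suc l))
      \<le> leaf_quotient M Y (c *\<^sub>R x + (\<Sum>l<K. t l *\<^sub>R e l))" for c t
    using a[of "\<lambda>i. case i of 0 \<Rightarrow> c | Suc l \<Rightarrow> t l"] a0
    by (simp add: K0 sum.reindex v_def)
  have ev: "(\<Sum>l<K. t l *\<^sub>R e l) (real l' / 2 ^ M) = t l'" if "l' < K" for t l'
  proof -
    have "(\<Sum>l<K. t l *\<^sub>R e l) (real l' / 2 ^ M) = (\<Sum>l<K. t l * of_bool (l = l'))"
      by (simp add: sum_fun_apply scaleR_fun_def e)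
    then show ?thesis using that by (simp add: of_bool_def if_distrib cong: if_cong)
  qed
  have zero: "leaf_quotient M Y y = 0" if "y \<in> Y" for y
  proof -
    have "leaf_quotient M Y y \<le> leaf_norm M (y + - y)"
      by (rule leaf_quotient_le) (rule subspace_neg[OF Y that])
    then have "leaf_quotient M Y y \<le> 0" by (simp add: leaf_norm_def)
    then show ?thesis using leaf_quotient_nonneg[OF Y, of M y] by simp
  qed
  define L where "L t = (\<Sum>l<K. t l * a (Suc l))" for t
  \<comment> \<open>The functional inequality for any \<open>f\<close> with the right samples. The
    choices \<open>f = 0\<close>, \<open>f = y\<close> and \<open>f = c *\<^sub>R e l\<close>, each
    with both signs, yield the three claims below.\<close>
  have bL: "c * leaf_quotient M Y x + L t \<le> leaf_quotient M Y f"
    if "\<And>l. l < K \<Longrightarrow> f (real l / 2 ^ M) = c * x (real l / 2 ^ M) + t l" for c t f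
  proof -
    have "leaf_quotient M Y (c *\<^sub>R x + (\<Sum>l<K. t l *\<^sub>R e l)) = leaf_quotient M Y f"
      by (rule leaf_quotient_cong) (use that ev in \<open>simp add: scaleR_fun_def K_def\<close>)
    then show ?thesis using b[of c t] by (simp add: L_def)
  qed
  have L_neg: "L (\<lambda>l. - t l) = - L t" for t by (simp add: L_def sum_negf)
  \<comment> \<open>The factor \<open>2 ^ M\<close> undoes the averaging in
    \<open>leaf_pairing\<close>.\<close>
  define \<phi> where "\<phi> l = 2 ^ M * a (Suc l)" for l
  have pair: "leaf_pairing M \<phi> f = L (\<lambda>l. f (real l / 2 ^ M))" for f
    by (simp add: leaf_pairing_def \<phi>_def L_def K_def sum_divide_distrib mult.commute)
  have null0: "leaf_quotient M Y 0 = 0" using zero subspace_0[OF Y] by blast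
  show ?thesis
  proof (rule that)
    have "1 * leaf_quotient M Y x + L (\<lambda>l. - x (real l / 2 ^ M)) \<le> leaf_quotient M Y 0"
      by (rule bL) simp
    moreover have "-1 * leaf_quotient M Y x + L (\<lambda>l. x (real l / 2 ^ M)) \<le> leaf_quotient M Y 0"
      by (rule bL) simp
    ultimately show "leaf_pairing M \<phi> x = leaf_quotient M Y x"
      unfolding pair L_neg null0 by simp
  next
    fix y assume y: "y \<in> Y"
    have "0 * leaf_quotient M Y x + L (\<lambda>l. y (real l / 2 ^ M)) \<le> leaf_quotient M Y y"
      by (rule bL) simp
    moreover have "0 * leaf_quotient M Y x + L (\<lambda>l. - y (real l / 2 ^ M)) \<le> leaf_quotient M Y (- y)"
      by (rule bL) simp
    ultimately show "leaf_pairing M \<phi> y = 0"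
      unfolding pair L_neg using zero y subspace_neg[OF Y y] by simp
  next
    fix l :: nat assume l: "l < 2 ^ M"
    have norm_e: "leaf_quotient M Y (c *\<^sub>R e l) \<le> \<bar>c\<bar> / 2 ^ M" for c
    proof -
      have "leaf_quotient M Y (c *\<^sub>R e l) \<le> leaf_norm M (c *\<^sub>R e l + 0)"
        by (rule leaf_quotient_le) (rule subspace_0[OF Y])
      also have "\<dots> = \<bar>c\<bar> * leaf_norm M (e l)" by (simp only: add_0_right leaf_norm_scaleR)
      also have "leaf_norm M (e l) = (\<Sum>l'<2 ^ M. of_bool (l = l')) / 2 ^ M"
        unfolding leaf_norm_def e by simp
      also have "(\<Sum>l'<2 ^ M. of_bool (l = l')) = (1 :: real)"
        using l by (simp add: of_bool_def)
      finally show ?thesis by simp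
    qed
    have L1: "L (\<lambda>l'. c * of_bool (l = l')) = c * a (Suc l)" for c
      using l by (simp add: L_def K_def of_bool_def if_distrib if_distribR cong: if_cong)
    have "0 * leaf_quotient M Y x + L (\<lambda>l'. c * of_bool (l = l')) \<le> leaf_quotient M Y (c *\<^sub>R e l)" for c
      by (rule bL) (simp add: scaleR_fun_def e)
    then have "c * a (Suc l) \<le> \<bar>c\<bar> / 2 ^ M" for c
      using norm_e order_trans unfolding L1 by fastforce
    from this[of 1] this[of "-1"] show "\<bar>\<phi> l\<bar> \<le> 1"
      by (simp add: \<phi>_def abs_le_iff field_simps)
  qed
qed

section \<open>Step functions on dyadic intervals\<close>

text \<open>Constant on each leaf and zero off \<open>[0, 1)\<close>, stated through the left
  endpoints that \<open>leaf_norm\<close> samples.\<close>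

definition leafwise :: "nat \<Rightarrow> (real \<Rightarrow> real) \<Rightarrow> bool" where
  "leafwise M f \<longleftrightarrow> (\<forall>t. f t = (if 0 \<le> t \<and> t < 1 then f (of_int \<lfloor>2 ^ M * t\<rfloor> / 2 ^ M) else 0))"

lemma subspace_leafwise: "subspace (Collect (leafwise M))"
proof (rule subspaceI)
  show "0 \<in> Collect (leafwise M)" by (simp add: leafwise_def)
next
  fix f g :: "real \<Rightarrow> real" assume "f \<in> Collect (leafwise M)" "g \<in> Collect (leafwise M)"
  then have fg: "f t = (if 0 \<le> t \<and> t < 1 then f (of_int \<lfloor>2 ^ M * t\<rfloor> / 2 ^ M) else 0)"
    "g t = (if 0 \<le> t \<and> t < 1 then g (of_int \<lfloor>2 ^ M * t\<rfloor> / 2 ^ M) else 0)" for t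
    unfolding leafwise_def by blast+
  show "f + g \<in> Collect (leafwise M)"
    unfolding leafwise_def mem_Collect_eq
  proof
    fix t show "(f + g) t = (if 0 \<le> t \<and> t < 1 then (f + g) (of_int \<lfloor>2 ^ M * t\<rfloor> / 2 ^ M) else 0)"
      using fg[of t] by (auto split: if_splits)
  qed
next
  fix c and f :: "real \<Rightarrow> real" assume "f \<in> Collect (leafwise M)"
  then have f: "f t = (if 0 \<le> t \<and> t < 1 then f (of_int \<lfloor>2 ^ M * t\<rfloor> / 2 ^ M) else 0)" for t
    unfolding leafwise_def by blast
  show "c *\<^sub>R f \<in> Collect (leafwise M)"
    unfolding leafwise_def mem_Collect_eq
  proof
    fix t show "(c *\<^sub>R f) t = (if 0 \<le> t \<and> t < 1 then (c *\<^sub>R f) (of_int \<lfloor>2 ^ M * t\<rfloor> / 2 ^ M) else 0)"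
      using f[of t] by (auto simp: scaleR_fun_def split: if_splits)
  qed
qed

definition leaf_block :: "nat \<Rightarrow> nat \<Rightarrow> nat \<Rightarrow> real set" where
  "leaf_block M d a = {real (a * 2 ^ d) / 2 ^ M ..< real ((a + 1) * 2 ^ d) / 2 ^ M}"

lemma leafwise_leaf_block:
  assumes "(a + 1) * 2 ^ d \<le> 2 ^ M"
  shows "leafwise M (indicator (leaf_block M d a))"
  unfolding leafwise_def
proof
  fix t :: real
  define u where "u = a * 2 ^ d"
  define w where "w = (a + 1) * 2 ^ d"
  have mem: "r \<in> leaf_block M d a \<longleftrightarrow> real u \<le> 2 ^ M * r \<and> 2 ^ M * r < real w" for r
    by (simp add: leaf_block_def u_def w_def divide_le_eq less_divide_eq mult.commute del: of_nat_mult of_nat_add)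
  have "of_int \<lfloor>2 ^ M * t\<rfloor> / 2 ^ M \<in> leaf_block M d a \<longleftrightarrow> t \<in> leaf_block M d a"
  proof -
    have "real u \<le> of_int \<lfloor>2 ^ M * t\<rfloor> \<longleftrightarrow> int u \<le> \<lfloor>2 ^ M * t\<rfloor>"
      "of_int \<lfloor>2 ^ M * t\<rfloor> < real w \<longleftrightarrow> \<lfloor>2 ^ M * t\<rfloor> < int w"
      by (metis of_int_le_iff of_int_of_nat_eq) (metis of_int_less_iff of_int_of_nat_eq)
    then show ?thesis unfolding mem by (simp add: le_floor_iff floor_less_iff)
  qed
  moreover have "0 \<le> t \<and> t < 1" if "t \<in> leaf_block M d a"
  proof -
    have "real w \<le> real (2 ^ M)" using assms unfolding w_def of_nat_le_iff .
    then have "real w \<le> 2 ^ M * 1" by (simp only: of_nat_power of_nat_numeral mult_1_right)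
    then have "2 ^ M * t < 2 ^ M * 1" using that unfolding mem by linarith
    moreover have "2 ^ M * 0 \<le> 2 ^ M * t" using that unfolding mem by simp
    moreover have "(0 :: real) < 2 ^ M" by simp
    ultimately show ?thesis by (simp only: mult_le_cancel_left_pos mult_less_cancel_left_pos)
  qed
  ultimately show "(indicator (leaf_block M d a) t :: real) =
      (if 0 \<le> t \<and> t < 1 then indicator (leaf_block M d a) (of_int \<lfloor>2 ^ M * t\<rfloor> / 2 ^ M) else 0)"
    by (auto simp: indicator_def)
qed

lemma leaf_block_leaf: "real l / 2 ^ M \<in> leaf_block M d a \<longleftrightarrow> l div 2 ^ d = a"
proof -
  have "real l / 2 ^ M \<in> leaf_block M d a \<longleftrightarrow> a * 2 ^ d \<le> l \<and> l < (a + 1) * 2 ^ d"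
    unfolding leaf_block_def atLeastLessThan_iff by (simp add: divide_le_cancel divide_less_cancel del: of_nat_mult of_nat_add)
  also have "\<dots> \<longleftrightarrow> l div 2 ^ d = a"
    by (simp only: less_eq_div_iff_mult_less_eq[symmetric] div_less_iff_less_mult[symmetric] zero_less_power zero_less_numeral) auto
  finally show ?thesis .
qed

text \<open>An interval of length \<open>1 / 2 ^ k\<close> is the node \<open>(Suc d, a)\<close>
  with \<open>k + d = N\<close>, and its halves are the children \<open>(d, 2 * a)\<close> and
  \<open>(d, 2 * a + 1)\<close>. Depth \<open>Suc N\<close> is required because the shortest
  intervals, of length \<open>1 / 2 ^ N\<close>, are still halved.\<close>

lemma haar_dyadic:
  assumes "I \<in> dyadic_upto N"
  obtains k d a where "k + d = N" "a < 2 ^ k"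
    "haar I = indicator (leaf_block (Suc N) d (2 * a)) - indicator (leaf_block (Suc N) d (2 * a + 1))"
proof -
  obtain i k where I: "I = {(real i - 1) / 2 ^ k ..< real i / 2 ^ k}" "1 \<le> i" "i \<le> 2 ^ k"
    and meas: "measure lborel I \<ge> 1 / 2 ^ N"
    using assms by (auto simp: dyadic_upto_def dyadic_def)
  define a where "a = i - 1"
  have i: "real i = real a + 1" "a < 2 ^ k" using I by (auto simp: a_def)
  have lt: "real a / 2 ^ k < (real a + 1) / 2 ^ k" by (simp add: divide_less_cancel)
  have I': "I = {real a / 2 ^ k ..< (real a + 1) / 2 ^ k}" using I i by simp
  have "1 / 2 ^ N \<le> (1 :: real) / 2 ^ k"
    using meas lt unfolding I' by (simp add: diff_divide_distrib[symmetric])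
  then have "k \<le> N" by (simp add: divide_le_cancel frac_le_eq field_simps)
  then obtain d where d: "k + d = N" using le_Suc_ex by metis
  have mid: "(Inf I + Sup I) / 2 = (2 * real a + 1) / 2 ^ Suc k"
    unfolding I' using lt by (simp add: field_simps)
  have scale: "real u / 2 ^ Suc k = real (u * 2 ^ d) / 2 ^ Suc N" for u :: nat
    unfolding d[symmetric] by (simp add: power_add)
  have half: "real a / 2 ^ k = real (2 * a) / 2 ^ Suc k" "(2 * real a + 1) / 2 ^ Suc k = real (2 * a + 1) / 2 ^ Suc k"
    "(real a + 1) / 2 ^ k = real (2 * a + 1 + 1) / 2 ^ Suc k"
    by (simp_all add: field_simps)
  have ord: "real a / 2 ^ k \<le> (2 * real a + 1) / 2 ^ Suc k" "(2 * real a + 1) / 2 ^ Suc k \<le> (real a + 1) / 2 ^ k"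
    by (simp_all add: field_simps)
  have "left_half I = {real a / 2 ^ k ..< (2 * real a + 1) / 2 ^ Suc k}"
    unfolding left_half_def mid using ord by (auto simp: I')
  then have left: "left_half I = leaf_block (Suc N) d (2 * a)"
    unfolding half scale leaf_block_def .
  have "right_half I = {(2 * real a + 1) / 2 ^ Suc k ..< (real a + 1) / 2 ^ k}"
    unfolding right_half_def mid using ord by (auto simp: I')
  then have right: "right_half I = leaf_block (Suc N) d (2 * a + 1)"
    unfolding half scale leaf_block_def .
  show ?thesis by (rule that[OF d i(2)]) (simp only: haar_def left right)
qed

lemma leaf_block_bound:
  fixes a :: nat
  assumes "k + d = N" "a < 2 ^ k" "b \<le> 2 * a + 1"
  shows "(b + 1) * 2 ^ d \<le> 2 ^ Suc N"
proof -
  have "(b + 1) * 2 ^ d \<le> (2 * 2 ^ k) * 2 ^ d" using assms by (intro mult_right_mono) auto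
  then show ?thesis by (simp add: power_add flip: assms(1))
qed

lemma L1_level_leafwise:
  assumes "f \<in> L1_level N"
  shows "leafwise (Suc N) f"
proof -
  have "{indicator {0..<1}} \<union> haar ` dyadic_upto N \<subseteq> Collect (leafwise (Suc N))"
  proof -
    have "leaf_block (Suc N) (Suc N) 0 = {0..<1}" by (simp add: leaf_block_def)
    then have "leafwise (Suc N) (indicator {0..<1})" using leafwise_leaf_block[of 0 "Suc N" "Suc N"] by simp
    moreover have "leafwise (Suc N) (haar I)" if "I \<in> dyadic_upto N" for I
      using that
    proof (rule haar_dyadic)
      fix k d a assume *: "k + d = N" "a < 2 ^ k"
        "haar I = indicator (leaf_block (Suc N) d (2 * a)) - indicator (leaf_block (Suc N) d (2 * a + 1))"
      have "indicator (leaf_block (Suc N) d (2 * a)) - indicator (leaf_block (Suc N) d (2 * a + 1)) \<in> Collect (leafwise (Suc N))"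
        using leafwise_leaf_block[OF leaf_block_bound[OF *(1,2)]]
        by (intro subspace_diff[OF subspace_leafwise]) auto
      then show ?thesis using *(3) by simp
    qed
    ultimately show ?thesis by auto
  qed
  then have "L1_level N \<subseteq> Collect (leafwise (Suc N))"
    unfolding L1_level_def by (rule span_minimal[OF _ subspace_leafwise])
  then show ?thesis using assms by auto
qed

lemma L1_norm_leafwise:
  assumes "leafwise M f"
  shows "L1_norm f = leaf_norm M f"
proof -
  have pt: "indicator {0..1} t *\<^sub>R \<bar>f t\<bar> = (\<Sum>l<2 ^ M. \<bar>f (real l / 2 ^ M)\<bar> * indicator (leaf_block M 0 l) t)" for t
  proof (cases "0 \<le> t \<and> t < 1")
    case True
    define l0 where "l0 = nat \<lfloor>2 ^ M * t\<rfloor>"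
    have fl: "\<lfloor>2 ^ M * t\<rfloor> = int l0" using True by (simp add: l0_def)
    have "real l0 = of_int \<lfloor>2 ^ M * t\<rfloor>" by (simp add: fl)
    also have "\<dots> \<le> 2 ^ M * t" by simp
    also have "\<dots> < 2 ^ M * 1" using True by (intro mult_strict_left_mono) auto
    finally have "real l0 < real (2 ^ M)" by simp
    then have l0: "l0 < 2 ^ M" by (simp only: of_nat_less_iff)
    have "t \<in> leaf_block M 0 l \<longleftrightarrow> l = l0" for l
    proof -
      have "t \<in> leaf_block M 0 l \<longleftrightarrow> real l \<le> 2 ^ M * t \<and> 2 ^ M * t < real l + 1"
        by (simp add: leaf_block_def divide_le_eq less_divide_eq mult.commute add.commute)
      also have "\<dots> \<longleftrightarrow> \<lfloor>2 ^ M * t\<rfloor> = int l" by (simp add: floor_eq_iff)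
      finally show ?thesis unfolding fl by auto
    qed
    then have "(\<Sum>l<2 ^ M. \<bar>f (real l / 2 ^ M)\<bar> * indicator (leaf_block M 0 l) t) =
        (\<Sum>l<2 ^ M. if l = l0 then \<bar>f (real l / 2 ^ M)\<bar> else 0)"
      by (intro sum.cong) (auto simp: indicator_def)
    also have "\<dots> = \<bar>f (real l0 / 2 ^ M)\<bar>" using l0 by simp
    also have "f (real l0 / 2 ^ M) = f t"
      using assms True unfolding leafwise_def by (metis fl of_int_of_nat_eq)
    finally show ?thesis using True by simp
  next
    case False
    have "t \<notin> leaf_block M 0 l" if "l < 2 ^ M" for l
    proof
      assume t: "t \<in> leaf_block M 0 l"
      have "real (l + 1) \<le> real (2 ^ M)" using that unfolding of_nat_le_iff by simp
      then have "real (l + 1) / 2 ^ M \<le> 1" by simp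
      moreover have "0 \<le> real l / 2 ^ M" by simp
      moreover have "real l / 2 ^ M \<le> t" "t < real (l + 1) / 2 ^ M" using t by (simp_all add: leaf_block_def)
      ultimately show False using False by linarith
    qed
    \<comment> \<open>This covers \<open>t = 1\<close>, which lies in the closed domain of
      integration but in no leaf.\<close>
    moreover have "f t = 0" using assms False unfolding leafwise_def by (metis)
    ultimately show ?thesis by simp
  qed
  have int: "integrable lborel (\<lambda>t. \<bar>f (real l / 2 ^ M)\<bar> * indicator (leaf_block M 0 l) t)" for l
    unfolding leaf_block_def
    by (intro integrable_mult_right integrable_real_indicator) (simp_all add: divide_right_mono)
  have meas: "measure lborel (leaf_block M 0 l) = 1 / 2 ^ M" for l
    unfolding leaf_block_def by (simp add: divide_right_mono diff_divide_distrib[symmetric])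
  have "L1_norm f = (LINT t|lborel. (\<Sum>l<2 ^ M. \<bar>f (real l / 2 ^ M)\<bar> * indicator (leaf_block M 0 l) t))"
    unfolding L1_norm_def set_lebesgue_integral_def pt ..
  also have "\<dots> = (\<Sum>l<2 ^ M. LINT t|lborel. \<bar>f (real l / 2 ^ M)\<bar> * indicator (leaf_block M 0 l) t)"
    by (rule Bochner_Integration.integral_sum[OF int])
  also have "\<dots> = (\<Sum>l<2 ^ M. \<bar>f (real l / 2 ^ M)\<bar> * (1 / 2 ^ M))"
    by (simp add: meas)
  finally show ?thesis by (simp add: leaf_norm_def sum_divide_distrib)
qed

lemma quotient_norm_leafwise:
  assumes "leafwise M x" "\<And>y. y \<in> Y \<Longrightarrow> leafwise M y"
  shows "quotient_norm Y x = leaf_quotient M Y x"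
proof -
  have "L1_norm (x + y) = leaf_norm M (x + y)" if "y \<in> Y" for y
    using subspace_add[OF subspace_leafwise, of x M y] assms that by (intro L1_norm_leafwise) simp
  then show ?thesis unfolding quotient_norm_def leaf_quotient_def by simp
qed

text \<open>The dictionary between the two pictures: annihilating a Haar function means that the
  martingale does not move at its node.\<close>

lemma leaf_pairing_haar:
  assumes "k + d = N" "a < 2 ^ k"
    "haar I = indicator (leaf_block (Suc N) d (2 * a)) - indicator (leaf_block (Suc N) d (2 * a + 1))"
  shows "leaf_pairing (Suc N) \<phi> (haar I) = 0 \<longleftrightarrow> block_mean \<phi> d (2 * a) = block_mean \<phi> d (2 * a + 1)"
proof -
  have blk: "(\<Sum>l<2 ^ Suc N. \<phi> l * indicator (leaf_block (Suc N) d b) (real l / 2 ^ Suc N)) = 2 ^ d * block_mean \<phi> d b"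
    if "b \<le> 2 * a + 1" for b
  proof -
    have sub: "{l. l div 2 ^ d = b} \<subseteq> {..<2 ^ Suc N}"
    proof
      fix l assume "l \<in> {l. l div 2 ^ d = b}"
      then have "l < (b + 1) * 2 ^ d" using dividend_less_div_times[of "2 ^ d" l] by auto
      also have "\<dots> \<le> 2 ^ Suc N" by (rule leaf_block_bound[OF assms(1,2) that])
      finally show "l \<in> {..<2 ^ Suc N}" by simp
    qed
    have "(\<Sum>l<2 ^ Suc N. \<phi> l * indicator (leaf_block (Suc N) d b) (real l / 2 ^ Suc N)) = (\<Sum>l<2 ^ Suc N. if l div 2 ^ d = b then \<phi> l else 0)"
      by (intro sum.cong refl) (simp add: indicator_def leaf_block_leaf del: power_Suc)
    also have "\<dots> = (\<Sum>l \<in> {l. l div 2 ^ d = b}. \<phi> l)"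
      by (intro sum.mono_neutral_cong_right sub) auto
    finally show ?thesis unfolding block_mean_sum .
  qed
  have "leaf_pairing (Suc N) \<phi> (haar I) = (2 ^ d * block_mean \<phi> d (2 * a) - 2 ^ d * block_mean \<phi> d (2 * a + 1)) / 2 ^ Suc N"
    unfolding leaf_pairing_def assms(3) using blk[of "2 * a"] blk[of "2 * a + 1"]
    by (simp add: right_diff_distrib sum_subtractf del: power_Suc)
  then show ?thesis by (simp add: right_diff_distrib[symmetric])
qed

lemma leaf_pairing_scaleR: "leaf_pairing M \<phi> (c *\<^sub>R f) = c * leaf_pairing M \<phi> f"
  by (simp add: leaf_pairing_def scaleR_fun_def sum_distrib_left mult_ac)

lemma leaf_pairing_sum: "leaf_pairing M \<phi> (\<Sum>i\<in>J. f i) = (\<Sum>i\<in>J. leaf_pairing M \<phi> (f i))"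
  unfolding leaf_pairing_def sum_fun_apply sum_distrib_left sum_divide_distrib by (subst sum.swap) simp

lemma leaf_pairing_cmult: "leaf_pairing M (\<lambda>l. c * \<phi> l) f = c * leaf_pairing M \<phi> f"
  by (simp add: leaf_pairing_def sum_distrib_left mult.assoc)

lemma leaf_pairing_diff: "leaf_pairing M (\<lambda>l. \<phi> l - \<psi> l) f = leaf_pairing M \<phi> f - leaf_pairing M \<psi> f"
  by (simp add: leaf_pairing_def left_diff_distrib sum_subtractf diff_divide_distrib)

lemma leaf_pairing_mean:
  "leaf_pairing M (\<lambda>l. mean \<Omega> (\<lambda>\<omega>. \<phi> \<omega> l)) f = mean \<Omega> (\<lambda>\<omega>. leaf_pairing M (\<phi> \<omega>) f)"
proof -
  have "mean \<Omega> (\<lambda>\<omega>. leaf_pairing M (\<phi> \<omega>) f) = mean \<Omega> (\<lambda>\<omega>. (1 / 2 ^ M) * (\<Sum>l<2 ^ M. f (real l / 2 ^ M) * \<phi> \<omega> l))"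
    by (simp add: leaf_pairing_def mult.commute)
  also have "\<dots> = leaf_pairing M (\<lambda>l. mean \<Omega> (\<lambda>\<omega>. \<phi> \<omega> l)) f"
    unfolding mean_cmult mean_sum leaf_pairing_def by (simp add: mult.commute)
  finally show ?thesis ..
qed

lemma leaf_pairing_span:
  assumes "y \<in> span B" "\<And>b. b \<in> B \<Longrightarrow> leaf_pairing M \<phi> b = 0"
  shows "leaf_pairing M \<phi> y = 0"
proof -
  have "subspace {y. leaf_pairing M \<phi> y = 0}"
    by (rule subspaceI) (auto simp: leaf_pairing_add leaf_pairing_scaleR, simp add: leaf_pairing_def)
  then have "span B \<subseteq> {y. leaf_pairing M \<phi> y = 0}" using assms(2) by (intro span_minimal) auto
  then show ?thesis using assms(1) by auto
qed

lemma block_mean_apply: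
  fixes f :: "nat \<Rightarrow> 'b \<Rightarrow> real"
  shows "block_mean f d a j = block_mean (\<lambda>l. f l j) d a"
  by (induction d arbitrary: a) (simp_all add: scaleR_fun_def)

lemma annihilating_rademacher_lift:
  assumes A: "A \<subseteq> dyadic_upto N"
    and \<Phi>: "\<And>l. l < 2 ^ Suc N \<Longrightarrow> \<Phi> l \<in> l2_ball n"
      "\<And>j I. I \<in> A \<Longrightarrow> leaf_pairing (Suc N) (\<lambda>l. \<Phi> l j) (haar I) = 0"
  obtains s where "\<And>\<epsilon> I. I \<in> A \<Longrightarrow> leaf_pairing (Suc N) (\<lambda>l. s l \<epsilon>) (haar I) = 0"
    "\<And>l \<epsilon>. l < 2 ^ Suc N \<Longrightarrow> \<epsilon> \<in> sign_vectors n \<Longrightarrow> \<bar>s l \<epsilon>\<bar> < 1"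
    "\<And>l. l < 2 ^ Suc N \<Longrightarrow> (\<Sum>j=1..n. (\<Phi> l j - 10 ^ 11 * mean (sign_vectors n) (\<lambda>\<epsilon>. \<epsilon> j * s l \<epsilon>))\<^sup>2) \<le> 1 / 4"
proof -
  \<comment> \<open>Nodes enter \<open>T\<close> through their Haar functions, the form in which
    \<open>leaf_pairing_haar\<close> consumes them.\<close>
  define T where "T = {(Suc d, a) | k d a. k + d = N \<and> a < 2 ^ k \<and>
    (\<exists>I\<in>A. haar I = indicator (leaf_block (Suc N) d (2 * a)) - indicator (leaf_block (Suc N) d (2 * a + 1)))}"
  have bal: "balanced T \<Phi> (Suc N) 0"
  proof (rule balancedI)
    fix d a assume "(Suc d, a) \<in> T"
    then obtain k I where *: "I \<in> A" "k + d = N" "a < 2 ^ k"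
      "haar I = indicator (leaf_block (Suc N) d (2 * a)) - indicator (leaf_block (Suc N) d (2 * a + 1))"
      by (auto simp: T_def)
    show "block_mean \<Phi> d (2 * a) = block_mean \<Phi> d (2 * a + 1)"
    proof
      fix j show "block_mean \<Phi> d (2 * a) j = block_mean \<Phi> d (2 * a + 1) j"
        unfolding block_mean_apply using leaf_pairing_haar[OF *(2-4)] \<Phi>(2)[OF *(1)] by blast
    qed
  qed
  show ?thesis
  proof (rule bounded_rademacher_lift[of "Suc N" \<Phi> n T])
    fix s
    assume s: "balanced T s (Suc N) 0"
      "\<And>l \<epsilon>. l < 2 ^ Suc N \<Longrightarrow> \<epsilon> \<in> sign_vectors n \<Longrightarrow> \<bar>s l \<epsilon>\<bar> < 1"
      "\<And>l. l < 2 ^ Suc N \<Longrightarrow> (\<Sum>j=1..n. (\<Phi> l j - 10 ^ 11 * mean (sign_vectors n) (\<lambda>\<epsilon>. \<epsilon> j * s l \<epsilon>))\<^sup>2) \<le> 1 / 4"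
    have "leaf_pairing (Suc N) (\<lambda>l. s l \<epsilon>) (haar I) = 0" if I: "I \<in> A" for \<epsilon> I
    proof -
      obtain k d a where *: "k + d = N" "a < 2 ^ k"
        "haar I = indicator (leaf_block (Suc N) d (2 * a)) - indicator (leaf_block (Suc N) d (2 * a + 1))"
        using haar_dyadic A I by blast
      then have "(Suc d, a) \<in> T" using I by (auto simp: T_def)
      \<comment> \<open>The node is the descendant with index \<open>a\<close>, \<open>k\<close>
        levels below the root; \<open>k + Suc d = Suc N\<close>.\<close>
      moreover have "balanced T s (Suc d) (0 * 2 ^ k + a)"
        by (rule balanced_descend) (use s(1) * in simp_all)
      ultimately have "block_mean s d (2 * a) = block_mean s d (2 * a + 1)" by simp
      then have "block_mean (\<lambda>l. s l \<epsilon>) d (2 * a) = block_mean (\<lambda>l. s l \<epsilon>) d (2 * a + 1)"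
        unfolding block_mean_apply[symmetric] by simp
      then show ?thesis using leaf_pairing_haar[OF *] by blast
    qed
    from that[OF this s(2,3)] show ?thesis .
  qed (use \<Phi>(1) bal in blast)+
qed

section \<open>Duality and the final inequality\<close>

lemma rademacher_duality:
  fixes x :: "nat \<Rightarrow> real \<Rightarrow> real"
  assumes A: "A \<subseteq> dyadic_upto N" and Y: "Y = span (haar ` A)"
    and \<Phi>: "\<And>l. l < 2 ^ Suc N \<Longrightarrow> \<Phi> l \<in> l2_ball n"
      "\<And>j I. I \<in> A \<Longrightarrow> leaf_pairing (Suc N) (\<lambda>l. \<Phi> l j) (haar I) = 0"
  shows "(\<Sum>j=1..n. leaf_pairing (Suc N) (\<lambda>l. \<Phi> l j) (x j))
    \<le> 2 * 10 ^ 11 * mean (sign_vectors n) (\<lambda>\<epsilon>. leaf_quotient (Suc N) Y (\<Sum>j=1..n. \<epsilon> j *\<^sub>R x j))"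
proof -
  define M where "M = Suc N"
  define V where "V \<Phi> = (\<Sum>j=1..n. leaf_pairing M (\<lambda>l. \<Phi> l j) (x j))" for \<Phi> :: "nat \<Rightarrow> nat \<Rightarrow> real"
  define D where "D = {\<Phi>. (\<forall>l<2 ^ M. \<Phi> l \<in> l2_ball n) \<and> (\<forall>j. \<forall>I\<in>A. leaf_pairing M (\<lambda>l. \<Phi> l j) (haar I) = 0)}"
  define E where "E = mean (sign_vectors n) (\<lambda>\<epsilon>. leaf_quotient M Y (\<Sum>j=1..n. \<epsilon> j *\<^sub>R x j))"
  have Y_sub: "subspace Y" unfolding Y by (rule subspace_span)
  have coord: "\<bar>\<phi> j\<bar> \<le> 1" if "\<phi> \<in> l2_ball n" "j \<in> {1..n}" for \<phi> j
  proof -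
    have "(\<phi> j)\<^sup>2 \<le> (\<Sum>j=1..n. (\<phi> j)\<^sup>2)" using that by (intro member_le_sum) auto
    then have "(\<phi> j)\<^sup>2 \<le> 1" using that by (simp add: l2_ball_def)
    then show ?thesis by (simp add: abs_square_le_1)
  qed
  \<comment> \<open>A crude uniform bound by the norms of the \<open>x j\<close>, which are the
    quotient norms for \<open>{0}\<close>: \<open>K\<close> has to be finite before
    \<open>K / 2\<close> can be absorbed.\<close>
  have "V \<Phi> \<le> (\<Sum>j=1..n. leaf_quotient M {0} (x j))" if "\<Phi> \<in> D" for \<Phi>
    unfolding V_def
  proof (rule sum_mono)
    fix j assume j: "j \<in> {1..n}"
    have "subspace ({0} :: (real \<Rightarrow> real) set)" by (rule subspace_single_0)
    then show "leaf_pairing M (\<lambda>l. \<Phi> l j) (x j) \<le> leaf_quotient M {0} (x j)"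
      using that coord j by (intro leaf_pairing_le_quotient) (auto simp: D_def leaf_pairing_def)
  qed
  then have bdd: "bdd_above (V ` D)" by (auto intro!: bdd_aboveI)
  define K where "K = (SUP \<Phi>\<in>D. V \<Phi>)"
  have VK: "V \<Phi> \<le> K" if "\<Phi> \<in> D" for \<Phi> unfolding K_def by (rule cSUP_upper[OF that bdd])
  have half: "V \<Phi> \<le> 10 ^ 11 * E + K / 2" if \<Phi>: "\<Phi> \<in> D" for \<Phi>
  proof -
    obtain s where s: "\<And>\<epsilon> I. I \<in> A \<Longrightarrow> leaf_pairing M (\<lambda>l. s l \<epsilon>) (haar I) = 0"
      "\<And>l \<epsilon>. l < 2 ^ M \<Longrightarrow> \<epsilon> \<in> sign_vectors n \<Longrightarrow> \<bar>s l \<epsilon>\<bar> < 1"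
      "\<And>l. l < 2 ^ M \<Longrightarrow> (\<Sum>j=1..n. (\<Phi> l j - 10 ^ 11 * mean (sign_vectors n) (\<lambda>\<epsilon>. \<epsilon> j * s l \<epsilon>))\<^sup>2) \<le> 1 / 4"
      using annihilating_rademacher_lift[OF A, of \<Phi> n] \<Phi> unfolding D_def M_def by blast
    define \<Psi> where "\<Psi> l j = mean (sign_vectors n) (\<lambda>\<epsilon>. \<epsilon> j * s l \<epsilon>)" for l j
    have pair\<Psi>: "leaf_pairing M (\<lambda>l. \<Psi> l j) f = mean (sign_vectors n) (\<lambda>\<epsilon>. \<epsilon> j * leaf_pairing M (\<lambda>l. s l \<epsilon>) f)" for j f
      unfolding \<Psi>_def leaf_pairing_mean leaf_pairing_cmult ..
    \<comment> \<open>The error of the lift has squared norm at most 1/4, so doubling it gives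
      another admissible family, whose value is bounded by \<open>K\<close>.\<close>
    define \<Phi>' where "\<Phi>' l j = 2 * (\<Phi> l j - 10 ^ 11 * \<Psi> l j)" for l j
    have pair\<Phi>': "leaf_pairing M (\<lambda>l. \<Phi>' l j) f = 2 * (leaf_pairing M (\<lambda>l. \<Phi> l j) f - 10 ^ 11 * leaf_pairing M (\<lambda>l. \<Psi> l j) f)" for j f
      unfolding \<Phi>'_def leaf_pairing_cmult leaf_pairing_diff ..
    have "\<Phi>' \<in> D"
    proof -
      have "(\<Sum>j=1..n. (\<Phi>' l j)\<^sup>2) \<le> 1" if "l < 2 ^ M" for l
      proof -
        have "(\<Sum>j=1..n. (\<Phi>' l j)\<^sup>2) = 4 * (\<Sum>j=1..n. (\<Phi> l j - 10 ^ 11 * \<Psi> l j)\<^sup>2)"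
          unfolding \<Phi>'_def power_mult_distrib sum_distrib_left by simp
        then show ?thesis using s(3)[OF that] unfolding \<Psi>_def by simp
      qed
      moreover have "leaf_pairing M (\<lambda>l. \<Phi>' l j) (haar I) = 0" if "I \<in> A" for j I
        using \<Phi> that s(1)[OF that] unfolding pair\<Phi>' pair\<Psi> by (simp add: D_def mean_def)
      ultimately show ?thesis by (simp add: D_def l2_ball_def)
    qed
    then have "V \<Phi>' \<le> K" by (rule VK)
    moreover have "V \<Phi>' = 2 * (V \<Phi> - 10 ^ 11 * V \<Psi>)"
      unfolding V_def pair\<Phi>' by (simp add: sum_subtractf sum_distrib_left)
    moreover have "V \<Psi> \<le> E"
    proof -
      \<comment> \<open>The signs in the Rademacher coefficients pass to the \<open>x j\<close>, so
        a bounded annihilating functional meets the signed sum for each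
        \<open>\<epsilon>\<close>.\<close>
      have "V \<Psi> = mean (sign_vectors n) (\<lambda>\<epsilon>. leaf_pairing M (\<lambda>l. s l \<epsilon>) (\<Sum>j=1..n. \<epsilon> j *\<^sub>R x j))"
        unfolding V_def pair\<Psi> mean_sum[symmetric] leaf_pairing_sum leaf_pairing_scaleR ..
      also have "\<dots> \<le> E"
        unfolding E_def
      proof (rule mean_mono)
        fix \<epsilon> assume \<epsilon>: "\<epsilon> \<in> sign_vectors n"
        show "leaf_pairing M (\<lambda>l. s l \<epsilon>) (\<Sum>j=1..n. \<epsilon> j *\<^sub>R x j) \<le> leaf_quotient M Y (\<Sum>j=1..n. \<epsilon> j *\<^sub>R x j)"
        proof (rule leaf_pairing_le_quotient[OF Y_sub])
          show "\<bar>s l \<epsilon>\<bar> \<le> 1" if "l < 2 ^ M" for l using s(2)[OF that \<epsilon>] by simp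
          show "leaf_pairing M (\<lambda>l. s l \<epsilon>) y = 0" if "y \<in> Y" for y
            by (rule leaf_pairing_span[of _ "haar ` A"]) (use that s(1) Y in auto)
        qed
      qed
      finally show ?thesis .
    qed
    ultimately show ?thesis by simp
  qed
  have mem: "\<Phi> \<in> D" using \<Phi> by (simp add: D_def M_def)
  then have "K \<le> 10 ^ 11 * E + K / 2" unfolding K_def using half by (intro cSUP_least) (auto simp: K_def)
  then have "V \<Phi> \<le> 2 * 10 ^ 11 * E" using VK[OF mem] by simp
  then show ?thesis unfolding V_def E_def M_def .
qed

theorem theorem2:
  shows "\<exists>C::real. \<forall>(N::nat) (A::real set set) (n::nat) (x::nat \<Rightarrow> real \<Rightarrow> real) (Y::(real \<Rightarrow> real) set).
    A \<subseteq> dyadic_upto N \<longrightarrow> n \<ge> 1 \<longrightarrow> (\<forall>j\<in>{1..n}. x j \<in> L1_level N) \<longrightarrow> Y = span (haar ` A) \<longrightarrow>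
      sqrt (\<Sum>j=1..n. (quotient_norm Y (x j))\<^sup>2)
        \<le> C * sign_average n (\<lambda>\<epsilon>. quotient_norm Y (\<Sum>j=1..n. \<epsilon> j *\<^sub>R x j))"
proof (intro exI[of _ "2 * 10 ^ 11"] allI impI)
  fix N n :: nat and A :: "real set set" and x :: "nat \<Rightarrow> real \<Rightarrow> real" and Y :: "(real \<Rightarrow> real) set"
  assume A: "A \<subseteq> dyadic_upto N" and x: "\<forall>j\<in>{1..n}. x j \<in> L1_level N" and Y: "Y = span (haar ` A)"
  define M where "M = Suc N"
  have "span (haar ` A) \<subseteq> L1_level N"
    unfolding L1_level_def by (rule span_mono) (use A in auto)
  then have Y_leaf: "leafwise M y" if "y \<in> Y" for y
    using that L1_level_leafwise unfolding Y M_def by blast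
  have Y_sub: "subspace Y" unfolding Y by (rule subspace_span)
  define q where "q j = leaf_quotient M Y (x j)" for j
  have q: "quotient_norm Y (x j) = q j" if "j \<in> {1..n}" for j
    unfolding q_def using x that Y_leaf L1_level_leafwise by (intro quotient_norm_leafwise) (auto simp: M_def)
  have avg: "sign_average n (\<lambda>\<epsilon>. quotient_norm Y (\<Sum>j=1..n. \<epsilon> j *\<^sub>R x j)) =
      mean (sign_vectors n) (\<lambda>\<epsilon>. leaf_quotient M Y (\<Sum>j=1..n. \<epsilon> j *\<^sub>R x j))"
  proof -
    have "leafwise M (\<Sum>j=1..n. \<epsilon> j *\<^sub>R x j)" for \<epsilon>
    proof -
      have "(\<Sum>j=1..n. \<epsilon> j *\<^sub>R x j) \<in> L1_level N"
        unfolding L1_level_def by (intro span_sum span_scale) (use x in \<open>simp add: L1_level_def\<close>)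
      then show ?thesis unfolding M_def by (rule L1_level_leafwise)
    qed
    then have "quotient_norm Y (\<Sum>j=1..n. \<epsilon> j *\<^sub>R x j) = leaf_quotient M Y (\<Sum>j=1..n. \<epsilon> j *\<^sub>R x j)" for \<epsilon>
      using Y_leaf by (rule quotient_norm_leafwise)
    then show ?thesis unfolding sign_average_def mean_def by (simp only:)
  qed
  define S where "S = sqrt (\<Sum>j=1..n. (q j)\<^sup>2)"
  have S2: "S\<^sup>2 = (\<Sum>j=1..n. (q j)\<^sup>2)" by (simp add: S_def sum_nonneg)
  have "S \<le> 2 * 10 ^ 11 * mean (sign_vectors n) (\<lambda>\<epsilon>. leaf_quotient M Y (\<Sum>j=1..n. \<epsilon> j *\<^sub>R x j))"
  \<comment> \<open>Split off because the weights below divide by \<open>S\<close>.\<close>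
  proof (cases "S = 0")
    case True
    then show ?thesis using leaf_quotient_nonneg[OF Y_sub] by (simp add: mean_nonneg)
  next
    case False
    then have S: "S > 0" by (simp add: S_def sum_nonneg less_le)
    have "\<forall>j. \<exists>\<phi>. (\<forall>l<2 ^ M. \<bar>\<phi> l\<bar> \<le> 1) \<and> (\<forall>y\<in>Y. leaf_pairing M \<phi> y = 0) \<and> leaf_pairing M \<phi> (x j) = q j"
      unfolding q_def by (metis norming_leaf_functional[OF Y_sub])
    then obtain \<phi> where \<phi>: "\<And>j l. l < 2 ^ M \<Longrightarrow> \<bar>\<phi> j l\<bar> \<le> 1" "\<And>j y. y \<in> Y \<Longrightarrow> leaf_pairing M (\<phi> j) y = 0"
      "\<And>j. leaf_pairing M (\<phi> j) (x j) = q j" by metis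
    \<comment> \<open>Norming functionals weighted by the unit vector \<open>q j / S\<close> of
      \<open>l2\<close>: pointwise they stay in the ball, and the total pairing is
      \<open>(\<Sum>j=1..n. (q j)\<^sup>2) / S = S\<close>.\<close>
    define \<Phi> where "\<Phi> l j = q j / S * \<phi> j l" for l j
    have "\<Phi> l \<in> l2_ball n" if "l < 2 ^ M" for l
    proof -
      have "(\<Sum>j=1..n. (\<Phi> l j)\<^sup>2) \<le> (\<Sum>j=1..n. (q j / S)\<^sup>2 * 1)"
        unfolding \<Phi>_def power_mult_distrib
        using \<phi>(1)[OF that] by (intro sum_mono mult_left_mono) (auto simp: abs_square_le_1)
      also have "\<dots> = (\<Sum>j=1..n. (q j)\<^sup>2) / S\<^sup>2" by (simp add: power_divide sum_divide_distrib)
      also have "\<dots> = 1" unfolding S2[symmetric] using S by simp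
      finally show ?thesis by (simp add: l2_ball_def)
    qed
    moreover have "leaf_pairing M (\<lambda>l. \<Phi> l j) (haar I) = 0" if "I \<in> A" for j I
      unfolding \<Phi>_def leaf_pairing_cmult using \<phi>(2) that by (simp add: Y span_base)
    ultimately have "(\<Sum>j=1..n. leaf_pairing M (\<lambda>l. \<Phi> l j) (x j))
      \<le> 2 * 10 ^ 11 * mean (sign_vectors n) (\<lambda>\<epsilon>. leaf_quotient M Y (\<Sum>j=1..n. \<epsilon> j *\<^sub>R x j))"
      unfolding M_def by (intro rademacher_duality[OF A Y])
    moreover have "(\<Sum>j=1..n. leaf_pairing M (\<lambda>l. \<Phi> l j) (x j)) = S"
    proof -
      have "(\<Sum>j=1..n. leaf_pairing M (\<lambda>l. \<Phi> l j) (x j)) = (\<Sum>j=1..n. (q j)\<^sup>2) / S"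
        unfolding \<Phi>_def leaf_pairing_cmult \<phi>(3) sum_divide_distrib by (simp add: power2_eq_square)
      also have "\<dots> = S" unfolding S2[symmetric] using S by (simp add: power2_eq_square)
      finally show ?thesis .
    qed
    ultimately show ?thesis by simp
  qed
  moreover have "sqrt (\<Sum>j=1..n. (quotient_norm Y (x j))\<^sup>2) = S" unfolding S_def by (simp add: q)
  ultimately show "sqrt (\<Sum>j=1..n. (quotient_norm Y (x j))\<^sup>2)
        \<le> 2 * 10 ^ 11 * sign_average n (\<lambda>\<epsilon>. quotient_norm Y (\<Sum>j=1..n. \<epsilon> j *\<^sub>R x j))"
    unfolding avg by simp
qed

end
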